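(* Let $n\in\mathbb{N}_0$ and let $A^{[n]}\in\ell_{00}^{(d+1)\times(d+1)}(\mathbb{Z})$ be a mask whose subdivision operator $\mathcal{S}_{A^{[n]}}$ satisfies the $V_{d,\Lambda}$-spectral condition $$\mathcal{S}_{A^{[n]}}\,v_{f,n}=v_{f,n+1}\qquad\text{for all } f\in V_{d,\Lambda}.$$ Then there exists a mask $B^{[n]}\in\ell_{00}^{(d+1)\times(d+1)}(\mathbb{Z})$ such that $$\mathcal{H}_{d,2^{-(n+1)}\Lambda}\,\mathcal{S}_{A^{[n]}}=\mathcal{S}_{B^{[n]}}\,\mathcal{H}_{d,2^{-n}\Lambda},$$ or, in terms of symbols, $$H^*_{d,2^{-(n+1)}\Lambda}(z)\,\bigl(A^{[n]}\bigr)^*(z)=\bigl(B^{[n]}\bigr)^*(z)\,H^*_{d,2^{-n}\Lambda}(z^2).$$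
   Context: Sequences and operators. $\ell^{m}(\mathbb{Z})$ and $\ell^{m\times m}(\mathbb{Z})$ denote the spaces of all sequences indexed by $\mathbb{Z}$ of $m$-vectors and of $m\times m$ matrices; the subscript $00$ means finitely supported. Masks are real matrix valued; vector sequences may be complex valued (when imaginary frequencies occur), and operators act by the same formulas. The symbol of $A\in\ell_{00}^{m\times m}(\mathbb{Z})$ is $A^*(z)=\sum_{\alpha\in\mathbb{Z}}A(\alpha)z^\alpha$, $z\in\mathbb{C}\setminus\{0\}$. The subdivision operator with mask $A$ is $\mathcal{S}_A c(\alpha)=\sum_{\beta\in\mathbb{Z}}A(\alpha-2\beta)c(\beta)$. A convolution operator $\mathcal{H}$ with impulse response $H$ acts by $\mathcal{H}c=\sum_{\alpha}H(\cdot-\alpha)c(\alpha)$, and its symbol is $H^*(z)$. Function space. Let $p\ge 0$, $r\ge 1$ be integers, $d=p+2r$, and $\Lambda=\{\lambda_1,\dots,\lambda_r\}\subset\mathbb{R}\cup i\mathbb{R}$ with all $\lambda_j\neq0$ and $\lambda_i\neq\pm\lambda_j$ for $i\ne j$. Put $V_{d,\Lambda}=\mathrm{span}\{1,x,\dots,x^p,e^{\pm\lambda_1x},\dots,e^{\pm\lambda_rx}\}$. Write $2^{-n}\Lambda=\{2^{-n}\lambda_1,\dots,2^{-n}\lambda_r\}$. For a $d$ times continuously differentiable function $f$ on $\mathbb{R}$ and $n\in\mathbb{N}_0$, $v_{f,n}\in\ell^{d+1}(\mathbb{Z})$ is $v_{f,n}(\alpha)=\bigl[f(2^{-n}\alpha),\,2^{-n}f'(2^{-n}\alpha),\dots,2^{-nd}f^{(d)}(2^{-n}\alpha)\bigr]^T$.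 The operator $\mathcal{H}_{d,\Lambda}$. It is the convolution operator on $\ell^{d+1}(\mathbb{Z})$ with symbol (rows and columns indexed $0,\dots,d$) $$H_{d,\Lambda}^*(z)=\begin{bmatrix}T_p^*(z)&Q\\0&R^*(z)\end{bmatrix}.$$ Here $T_p^*(z)$ is the $(p+1)\times(p+1)$ upper triangular matrix with diagonal entries $z^{-1}-1$ and entries $-\frac{1}{(k'-k)!}$ at position $(k,k')$, $k<k'$. The matrix $R^*(z)=L_{d,\Lambda}\Delta_\Lambda^*(z)L_{d,\Lambda}^{-1}$ is $2r\times2r$, where $\Delta^*_\Lambda(z)=\mathrm{diag}(z^{-1}-e^{\lambda_1},z^{-1}-e^{-\lambda_1},\dots,z^{-1}-e^{\lambda_r},z^{-1}-e^{-\lambda_r})$ and $L_{d,\Lambda}$ is the (nonsingular) $2r\times 2r$ matrix whose columns are $[\mu^{p+1},\mu^{p+2},\dots,\mu^{d}]^T$ for $\mu=\lambda_1,-\lambda_1,\dots,\lambda_r,-\lambda_r$. Finally $Q=[h_{k,m}]_{k=0,\dots,p;\,m=p+1,\dots,d}$ is the constant (independent of $z$) matrix uniquely determined by $$\mu^ke^{\mu}-\sum_{i=0}^{p-k}\frac{\mu^{k+i}}{i!}+\sum_{m=p+1}^{d}\mu^m h_{k,m}=0,\qquad k=0,\dots,p,\ \mu\in\{\pm\lambda_1,\dots,\pm\lambda_r\}.$$ Equivalently, $H^*_{d,\Lambda}(e^{-\mu})[1,\mu,\dots,\mu^d]^T=0$ for all these $\mu$. *)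

theory Defs
  imports
    "HOL-Analysis.Derivative"
    "HOL-Library.Groups_Big_Fun"
    "Jordan_Normal_Form.Determinant"
    "Jordan_Normal_Form.Gauss_Jordan_Elimination"
begin

unbundle no vec_syntax

section \<open>Masks, symbols, subdivision and convolution operators\<close>

text \<open>
  Sequences over the integers are functions on type int with values in the vectors or
  matrices of Jordan_Normal_Form; the size m is an explicit argument. All sums over the
  integers are taken entrywise by \<^const>\<open>Sum_any\<close>, which is the ordinary sum whenever only
  finitely many terms are nonzero. This is the case wherever the sums are used with a
  finitely supported mask.
\<close>

definition is_mask :: "nat \<Rightarrow> (int \<Rightarrow> 'a::zero mat) \<Rightarrow> bool" where
  "is_mask m A \<longleftrightarrow> (\<forall>\<alpha>. A \<alpha> \<in> carrier_mat m m) \<and> finite {\<alpha>. A \<alpha> \<noteq> 0\<^sub>m m m}"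

definition symbol :: "nat \<Rightarrow> (int \<Rightarrow> complex mat) \<Rightarrow> complex \<Rightarrow> complex mat" where
  "symbol m A z = mat m m (\<lambda>(i, j). Sum_any (\<lambda>\<alpha>. A \<alpha> $$ (i, j) * z powi \<alpha>))"

definition subdivision ::
  "nat \<Rightarrow> (int \<Rightarrow> complex mat) \<Rightarrow> (int \<Rightarrow> complex vec) \<Rightarrow> int \<Rightarrow> complex vec" where
  "subdivision m A c = (\<lambda>\<alpha>. vec m (\<lambda>i. Sum_any (\<lambda>\<beta>. (A (\<alpha> - 2 * \<beta>) *\<^sub>v c \<beta>) $ i)))"

definition convolution ::
  "nat \<Rightarrow> (int \<Rightarrow> complex mat) \<Rightarrow> (int \<Rightarrow> complex vec) \<Rightarrow> int \<Rightarrow> complex vec" where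
  "convolution m H c = (\<lambda>\<alpha>. vec m (\<lambda>i. Sum_any (\<lambda>\<beta>. (H (\<alpha> - \<beta>) *\<^sub>v c \<beta>) $ i)))"

definition impulse_response ::
  "nat \<Rightarrow> (complex \<Rightarrow> complex mat) \<Rightarrow> int \<Rightarrow> complex mat" where
  "impulse_response m S = (THE H. is_mask m H \<and> (\<forall>z. z \<noteq> 0 \<longrightarrow> symbol m H z = S z))"

text \<open>Masks are real; they act on complex sequences through this embedding.\<close>

definition cmask :: "(int \<Rightarrow> real mat) \<Rightarrow> int \<Rightarrow> complex mat" where
  "cmask A = (\<lambda>\<alpha>. map_mat complex_of_real (A \<alpha>))"

section \<open>The function space and its Hermite samples\<close>

text \<open>
  The frequencies are given by a function of which only the values at 0, ..., r-1 matter.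
\<close>

definition admissible :: "nat \<Rightarrow> (nat \<Rightarrow> complex) \<Rightarrow> bool" where
  "admissible r lam \<longleftrightarrow>
     (\<forall>j<r. (Im (lam j) = 0 \<or> Re (lam j) = 0) \<and> lam j \<noteq> 0) \<and>
     (\<forall>i<r. \<forall>j<r. i \<noteq> j \<longrightarrow> lam i \<noteq> lam j \<and> lam i \<noteq> - lam j)"

definition scaled :: "nat \<Rightarrow> (nat \<Rightarrow> complex) \<Rightarrow> nat \<Rightarrow> complex" where
  "scaled n lam = (\<lambda>j. lam j / 2 ^ n)"

definition V_space :: "nat \<Rightarrow> nat \<Rightarrow> (nat \<Rightarrow> complex) \<Rightarrow> (real \<Rightarrow> complex) set" where
  "V_space p r lam =
     {f. \<exists>a b c. f = (\<lambda>x. (\<Sum>k\<le>p. a k * complex_of_real x ^ k) +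
           (\<Sum>j<r. b j * exp (lam j * complex_of_real x) +
                   c j * exp (- lam j * complex_of_real x)))}"

definition nth_deriv :: "nat \<Rightarrow> (real \<Rightarrow> complex) \<Rightarrow> real \<Rightarrow> complex" where
  "nth_deriv k = (\<lambda>g x. vector_derivative g (at x)) ^^ k"

definition hermite_seq :: "nat \<Rightarrow> (real \<Rightarrow> complex) \<Rightarrow> nat \<Rightarrow> int \<Rightarrow> complex vec" where
  "hermite_seq d f n =
     (\<lambda>\<alpha>. vec (d + 1) (\<lambda>k. (1 / 2) ^ (n * k) * nth_deriv k f (real_of_int \<alpha> / 2 ^ n)))"

section \<open>The annihilating operator\<close>

text \<open>The values of \<open>freq lam\<close> at 0, 1, 2, 3, ... are \<open>lam 0\<close>, \<open>- lam 0\<close>, \<open>lam 1\<close>, \<open>- lam 1\<close>, ...\<close>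

definition freq :: "(nat \<Rightarrow> complex) \<Rightarrow> nat \<Rightarrow> complex" where
  "freq lam c = (if even c then lam (c div 2) else - lam (c div 2))"

definition T_symbol :: "nat \<Rightarrow> complex \<Rightarrow> complex mat" where
  "T_symbol p z = mat (p + 1) (p + 1) (\<lambda>(k, k').
     if k = k' then inverse z - 1 else if k < k' then - 1 / fact (k' - k) else 0)"

definition L_mat :: "nat \<Rightarrow> nat \<Rightarrow> (nat \<Rightarrow> complex) \<Rightarrow> complex mat" where
  "L_mat p r lam = mat (2 * r) (2 * r) (\<lambda>(i, c). freq lam c ^ (p + 1 + i))"

definition Delta_symbol :: "nat \<Rightarrow> (nat \<Rightarrow> complex) \<Rightarrow> complex \<Rightarrow> complex mat" where
  "Delta_symbol r lam z = mat (2 * r) (2 * r) (\<lambda>(i, j).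
     if i = j then inverse z - exp (freq lam i) else 0)"

definition R_symbol :: "nat \<Rightarrow> nat \<Rightarrow> (nat \<Rightarrow> complex) \<Rightarrow> complex \<Rightarrow> complex mat" where
  "R_symbol p r lam z =
     L_mat p r lam * Delta_symbol r lam z * the (mat_inverse (L_mat p r lam))"

text \<open>Column j of Q carries the coefficients with second index m = p + 1 + j.\<close>

definition is_Q :: "nat \<Rightarrow> nat \<Rightarrow> (nat \<Rightarrow> complex) \<Rightarrow> complex mat \<Rightarrow> bool" where
  "is_Q p r lam Q \<longleftrightarrow> Q \<in> carrier_mat (p + 1) (2 * r) \<and>
     (\<forall>k\<le>p. \<forall>c<2 * r. let \<mu> = freq lam c in
        \<mu> ^ k * exp \<mu> - (\<Sum>i\<le>p - k. \<mu> ^ (k + i) / fact i)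
          + (\<Sum>m = p + 1..p + 2 * r. \<mu> ^ m * Q $$ (k, m - (p + 1))) = 0)"

definition Q_mat :: "nat \<Rightarrow> nat \<Rightarrow> (nat \<Rightarrow> complex) \<Rightarrow> complex mat" where
  "Q_mat p r lam = (THE Q. is_Q p r lam Q)"

definition H_symbol :: "nat \<Rightarrow> nat \<Rightarrow> (nat \<Rightarrow> complex) \<Rightarrow> complex \<Rightarrow> complex mat" where
  "H_symbol p r lam z =
     four_block_mat (T_symbol p z) (Q_mat p r lam) (0\<^sub>m (2 * r) (p + 1)) (R_symbol p r lam z)"

definition H_op ::
  "nat \<Rightarrow> nat \<Rightarrow> (nat \<Rightarrow> complex) \<Rightarrow> (int \<Rightarrow> complex vec) \<Rightarrow> int \<Rightarrow> complex vec" where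
  "H_op p r lam =
     convolution (p + 2 * r + 1) (impulse_response (p + 2 * r + 1) (H_symbol p r lam))"

section \<open>The objects above are well defined\<close>

lemma Sum_any_finite_poly_zero:
  fixes g :: "int \<Rightarrow> complex"
  assumes fin: "finite {a. g a \<noteq> 0}"
    and z: "\<And>z. z \<noteq> 0 \<Longrightarrow> Sum_any (\<lambda>a. g a * z powi a) = 0"
  shows "g a = 0"
proof (rule ccontr)
  assume a: "g a \<noteq> 0"
  define S where "S = {a. g a \<noteq> 0}"
  define N where "N = Min S"
  have finS: "finite S" and aS: "a \<in> S" using fin a by (auto simp: S_def)
  have N: "N \<le> b" if "b \<in> S" for b using finS that by (simp add: N_def)
  define P where "P = (\<Sum>b\<in>S. monom (g b) (nat (b - N)))"
  have "poly P w = 0" if "w \<noteq> 0" for w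
  proof -
    have "poly P w = (\<Sum>b\<in>S. g b * w ^ nat (b - N))"
      by (simp add: P_def poly_sum poly_monom)
    also have "\<dots> = (\<Sum>b\<in>S. g b * w powi b * w powi (- N))"
    proof (rule sum.cong[OF refl])
      fix b assume "b \<in> S"
      hence "w ^ nat (b - N) = w powi (b - N)" using N[of b] by (simp add: power_int_def)
      also have "\<dots> = w powi b * w powi (- N)"
        using that power_int_add[of w b "- N"] by simp
      finally show "g b * w ^ nat (b - N) = g b * w powi b * w powi (- N)" by simp
    qed
    also have "\<dots> = (\<Sum>b\<in>S. g b * w powi b) * w powi (- N)"
      by (simp only: sum_distrib_right)
    also have "(\<Sum>b\<in>S. g b * w powi b) = Sum_any (\<lambda>a. g a * w powi a)"
      by (rule Sum_any.expand_superset[symmetric]) (auto simp: finS S_def[symmetric], auto simp: S_def)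
    finally show ?thesis using z[OF that] by simp
  qed
  hence "- {0} \<subseteq> {w. poly P w = 0}" by auto
  moreover have "infinite (- {0::complex})"
    using infinite_UNIV_char_0[where 'a = complex] by (simp add: finite_compl)
  ultimately have "P = 0" using poly_roots_finite finite_subset by blast
  moreover have "coeff P (nat (a - N)) = (\<Sum>b\<in>S. if b = a then g b else 0)"
  proof -
    have "nat (b - N) = nat (a - N) \<longleftrightarrow> b = a" if "b \<in> S" for b
      using N[OF that] N[OF aS] by linarith
    thus ?thesis unfolding P_def coeff_sum by (intro sum.cong) (auto simp: coeff_monom)
  qed
  ultimately show False using finS aS a by simp
qed

lemma symbol_inj:
  assumes A: "is_mask m A" and B: "is_mask m B"
    and eq: "\<And>z. z \<noteq> 0 \<Longrightarrow> symbol m A z = symbol m B z"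
  shows "A = B"
proof
  fix a
  show "A a = B a"
  proof (rule eq_matI)
    fix i j assume "i < dim_row (B a)" "j < dim_col (B a)"
    moreover have car: "A a \<in> carrier_mat m m" "B a \<in> carrier_mat m m" for a
      using A B by (auto simp: is_mask_def)
    ultimately have ij: "i < m" "j < m" by (metis carrier_matD)+
    have fA: "finite {a. A a $$ (i, j) \<noteq> 0}"
      using A ij by (auto simp: is_mask_def elim!: rev_finite_subset)
    have fB: "finite {a. B a $$ (i, j) \<noteq> 0}"
      using B ij by (auto simp: is_mask_def elim!: rev_finite_subset)
    have "A a $$ (i, j) - B a $$ (i, j) = 0"
    proof (rule Sum_any_finite_poly_zero)
      show "finite {a. A a $$ (i, j) - B a $$ (i, j) \<noteq> 0}"
        by (rule finite_subset[OF _ finite_UnI[OF fA fB]]) auto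
      fix z :: complex assume "z \<noteq> 0"
      from arg_cong[OF eq[OF this], of "\<lambda>M. M $$ (i, j)"]
      have e: "Sum_any (\<lambda>a. A a $$ (i, j) * z powi a) = Sum_any (\<lambda>a. B a $$ (i, j) * z powi a)"
        using ij by (simp add: symbol_def)
      let ?S = "{a. A a $$ (i, j) \<noteq> 0} \<union> {a. B a $$ (i, j) \<noteq> 0}"
      have fS: "finite ?S" using fA fB by simp
      have ex: "Sum_any (\<lambda>a. h a * z powi a) = (\<Sum>a\<in>?S. h a * z powi a)"
        if "\<And>a. a \<notin> ?S \<Longrightarrow> h a = 0" for h
        by (rule Sum_any.expand_superset[OF fS]) (use that in force)
      have "Sum_any (\<lambda>a. (A a $$ (i, j) - B a $$ (i, j)) * z powi a) =
          (\<Sum>a\<in>?S. A a $$ (i, j) * z powi a) - (\<Sum>a\<in>?S. B a $$ (i, j) * z powi a)"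
        by (subst ex) (auto simp: left_diff_distrib sum_subtractf)
      also have "\<dots> = 0"
        using e ex[of "\<lambda>a. A a $$ (i, j)"] ex[of "\<lambda>a. B a $$ (i, j)"] by simp
      finally show "Sum_any (\<lambda>a. (A a $$ (i, j) - B a $$ (i, j)) * z powi a) = 0" .
    qed
    thus "A a $$ (i, j) = B a $$ (i, j)" by simp
  qed (use A B in \<open>auto simp: is_mask_def\<close>, metis carrier_matD(1), metis carrier_matD(2))
qed

lemma impulse_responseI:
  assumes "is_mask m H" "\<And>z. z \<noteq> 0 \<Longrightarrow> symbol m H z = S z"
  shows "impulse_response m S = H"
  unfolding impulse_response_def
  by (rule the_equality) (use assms symbol_inj[of m] in auto)

lemma admissible_scaled:
  assumes "admissible r lam"
  shows "admissible r (scaled n lam)"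
proof -
  have "scaled n lam j = complex_of_real (1 / 2 ^ n) * lam j" for j
    by (simp add: scaled_def)
  hence "Re (scaled n lam j) = 1 / 2 ^ n * Re (lam j)"
    and "Im (scaled n lam j) = 1 / 2 ^ n * Im (lam j)" for j
    by simp_all
  moreover have "scaled n lam i = scaled n lam j \<longleftrightarrow> lam i = lam j"
    "scaled n lam i = - scaled n lam j \<longleftrightarrow> lam i = - lam j"
    "scaled n lam j = 0 \<longleftrightarrow> lam j = 0" for i j
    by (simp_all add: scaled_def field_simps)
  ultimately show ?thesis using assms by (simp add: admissible_def)
qed

lemma freq_inj_on:
  assumes "admissible r lam"
  shows "inj_on (freq lam) {..<2 * r}" and "c < 2 * r \<Longrightarrow> freq lam c \<noteq> 0"
proof -
  show "c < 2 * r \<Longrightarrow> freq lam c \<noteq> 0"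
    using assms by (auto simp: admissible_def freq_def)
  show "inj_on (freq lam) {..<2 * r}"
  proof (rule inj_onI)
    fix a b assume ab: "a \<in> {..<2 * r}" "b \<in> {..<2 * r}" and e: "freq lam a = freq lam b"
    hence lt: "a div 2 < r" "b div 2 < r" by auto
    have d: "a div 2 = b div 2"
    proof (rule ccontr)
      assume "a div 2 \<noteq> b div 2"
      with lt assms have "lam (a div 2) \<noteq> lam (b div 2)" "lam (a div 2) \<noteq> - lam (b div 2)"
        by (auto simp: admissible_def)
      with e show False by (auto simp: freq_def split: if_splits) (metis add.inverse_inverse)+
    qed
    have "lam (a div 2) \<noteq> 0" using lt assms by (auto simp: admissible_def)
    with d e have "even a \<longleftrightarrow> even b" by (auto simp: freq_def split: if_splits)
    with d show "a = b" by (metis dvd_mult_div_cancel odd_two_times_div_two_succ)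
  qed
qed

lemma L_mat_det:
  assumes adm: "admissible r lam"
  shows "det (L_mat p r lam) \<noteq> 0"
proof
  let ?L = "L_mat p r lam"
  have L: "?L \<in> carrier_mat (2 * r) (2 * r)" by (simp add: L_mat_def)
  assume "det ?L = 0"
  hence "det (transpose_mat ?L) = 0" using det_transpose[OF L] by simp
  moreover have LT: "transpose_mat ?L \<in> carrier_mat (2 * r) (2 * r)" using L by simp
  ultimately obtain v where v: "v \<in> carrier_vec (2 * r)" "v \<noteq> 0\<^sub>v (2 * r)"
    and z: "transpose_mat ?L *\<^sub>v v = 0\<^sub>v (2 * r)"
    using det_0_iff_vec_prod_zero_field[OF LT] by blast
  define P where "P = (\<Sum>i<2 * r. monom (v $ i) i)"
  have co: "coeff P i = (if i < 2 * r then v $ i else 0)" for i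
    by (simp add: P_def coeff_sum coeff_monom)
  have root: "poly P (freq lam c) = 0" if c: "c < 2 * r" for c
  proof -
    have "0 = (transpose_mat ?L *\<^sub>v v) $ c" using z c by simp
    also have "\<dots> = (\<Sum>i<2 * r. freq lam c ^ (p + 1 + i) * v $ i)"
      using c v(1) by (simp add: L_mat_def scalar_prod_def lessThan_atLeast0)
    also have "\<dots> = freq lam c ^ (p + 1) * poly P (freq lam c)"
      by (simp add: P_def poly_sum poly_monom sum_distrib_left power_add mult_ac)
    finally show ?thesis using freq_inj_on(2)[OF adm c] by simp
  qed
  have "P = 0"
  proof (rule ccontr)
    assume P: "P \<noteq> 0"
    have "2 * r = card (freq lam ` {..<2 * r})"
      using freq_inj_on(1)[OF adm] by (simp add: card_image)
    also have "\<dots> \<le> card {x. poly P x = 0}"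
      using root by (intro card_mono poly_roots_finite[OF P]) auto
    also have "\<dots> \<le> degree P" by (rule card_poly_roots_bound[OF P])
    finally have "2 * r \<le> degree P" .
    moreover have "coeff P (degree P) \<noteq> 0" using P by simp
    ultimately show False by (simp add: co split: if_splits)
  qed
  hence "v $ i = 0" if "i < 2 * r" for i using co[of i] that by simp
  with v show False by auto
qed

lemma L_mat_inverse:
  fixes p :: nat
  assumes "admissible r lam"
  defines "L' \<equiv> the (mat_inverse (L_mat p r lam))"
  shows "L' \<in> carrier_mat (2 * r) (2 * r)"
    and "L_mat p r lam * L' = 1\<^sub>m (2 * r)" and "L' * L_mat p r lam = 1\<^sub>m (2 * r)"
proof -
  have L: "L_mat p r lam \<in> carrier_mat (2 * r) (2 * r)" by (simp add: L_mat_def)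
  have "L_mat p r lam \<in> Units (ring_mat TYPE(complex) (2 * r) ())"
    using det_non_zero_imp_unit[OF L L_mat_det[OF assms(1)]] .
  with mat_inverse(1)[OF L, of "()"] obtain X where X: "mat_inverse (L_mat p r lam) = Some X" by blast
  show "L' \<in> carrier_mat (2 * r) (2 * r)"
    and "L_mat p r lam * L' = 1\<^sub>m (2 * r)" and "L' * L_mat p r lam = 1\<^sub>m (2 * r)"
    using mat_inverse(2)[OF L X] by (auto simp: L'_def X)
qed

lemma is_Q_iff:
  "is_Q p r lam Q \<longleftrightarrow> Q \<in> carrier_mat (p + 1) (2 * r) \<and>
     Q * L_mat p r lam = mat (p + 1) (2 * r) (\<lambda>(k, c).
       (\<Sum>i\<le>p - k. freq lam c ^ (k + i) / fact i) - freq lam c ^ k * exp (freq lam c))"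
  (is "_ \<longleftrightarrow> _ \<and> _ = ?C")
proof -
  have *: "(Q * L_mat p r lam) $$ (k, c) =
      (\<Sum>m = p + 1..p + 2 * r. freq lam c ^ m * Q $$ (k, m - (p + 1)))"
    if "Q \<in> carrier_mat (p + 1) (2 * r)" "k \<le> p" "c < 2 * r" for k c
  proof -
    have "(Q * L_mat p r lam) $$ (k, c) = (\<Sum>i<2 * r. Q $$ (k, i) * freq lam c ^ (p + 1 + i))"
      using that by (simp add: L_mat_def scalar_prod_def lessThan_atLeast0)
    also have "\<dots> = (\<Sum>m = p + 1..p + 2 * r. freq lam c ^ m * Q $$ (k, m - (p + 1)))"
      by (rule sum.reindex_bij_witness[of _ "\<lambda>m. m - (p + 1)" "\<lambda>i. p + 1 + i"])
         (auto simp: mult.commute)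
    finally show ?thesis .
  qed
  show ?thesis
  proof (cases "Q \<in> carrier_mat (p + 1) (2 * r)")
    case Q: True
    hence "Q * L_mat p r lam = ?C \<longleftrightarrow> (\<forall>k\<le>p. \<forall>c<2 * r. (Q * L_mat p r lam) $$ (k, c) = ?C $$ (k, c))"
      by (auto simp: mat_eq_iff L_mat_def less_Suc_eq_le)
    also have "\<dots> \<longleftrightarrow> is_Q p r lam Q"
      using Q unfolding is_Q_def Let_def
      by (auto simp: *[OF Q] less_Suc_eq_le algebra_simps eq_diff_eq add_eq_0_iff)
    finally show ?thesis using Q by blast
  qed (simp add: is_Q_def)
qed

lemma ex1_Q:
  assumes adm: "admissible r lam"
  shows "\<exists>!Q. is_Q p r lam Q"
proof -
  note L' = L_mat_inverse[OF adm, of p]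
  have L: "L_mat p r lam \<in> carrier_mat (2 * r) (2 * r)" by (simp add: L_mat_def)
  define C where "C = mat (p + 1) (2 * r) (\<lambda>(k, c).
       (\<Sum>i\<le>p - k. freq lam c ^ (k + i) / fact i) - freq lam c ^ k * exp (freq lam c))"
  have C: "C \<in> carrier_mat (p + 1) (2 * r)" by (simp add: C_def)
  have iff: "is_Q p r lam Q \<longleftrightarrow> Q \<in> carrier_mat (p + 1) (2 * r) \<and> Q * L_mat p r lam = C" for Q
    by (simp only: is_Q_iff C_def)
  show ?thesis
  proof (rule ex1I[of _ "C * the (mat_inverse (L_mat p r lam))"])
    show "is_Q p r lam (C * the (mat_inverse (L_mat p r lam)))"
      unfolding iff using C L' L by (simp add: assoc_mult_mat[OF C L'(1) L])
    fix Q assume "is_Q p r lam Q"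
    hence Q: "Q \<in> carrier_mat (p + 1) (2 * r)" and e: "Q * L_mat p r lam = C"
      unfolding iff by auto
    show "Q = C * the (mat_inverse (L_mat p r lam))"
      using Q L' by (simp add: e[symmetric] assoc_mult_mat[OF Q L L'(1)])
  qed
qed

lemma is_Q_Q_mat: "admissible r lam \<Longrightarrow> is_Q p r lam (Q_mat p r lam)"
  unfolding Q_mat_def by (rule theI'[OF ex1_Q])

text \<open>The impulse response with symbol \<open>H_symbol\<close> is supported on -1 and 0.\<close>

definition H_const :: "nat \<Rightarrow> nat \<Rightarrow> (nat \<Rightarrow> complex) \<Rightarrow> complex mat" where
  "H_const p r lam = H_symbol p r lam 1 - 1\<^sub>m (p + 2 * r + 1)"

lemma H_symbol_affine:
  assumes adm: "admissible r lam"
  shows "H_const p r lam \<in> carrier_mat (p + 2 * r + 1) (p + 2 * r + 1)"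
    and "H_symbol p r lam z = inverse z \<cdot>\<^sub>m 1\<^sub>m (p + 2 * r + 1) + H_const p r lam"
proof -
  note L' = L_mat_inverse[OF adm, of p]
  let ?L = "L_mat p r lam" and ?L' = "the (mat_inverse (L_mat p r lam))"
  have L: "?L \<in> carrier_mat (2 * r) (2 * r)" by (simp add: L_mat_def)
  have D: "Delta_symbol r lam w \<in> carrier_mat (2 * r) (2 * r)" for w
    by (simp add: Delta_symbol_def)
  have T: "T_symbol p w \<in> carrier_mat (p + 1) (p + 1)" for w by (simp add: T_symbol_def)
  have Q: "Q_mat p r lam \<in> carrier_mat (p + 1) (2 * r)"
    using is_Q_Q_mat[OF adm, of p] by (simp add: is_Q_def)
  have R: "R_symbol p r lam w \<in> carrier_mat (2 * r) (2 * r)" for w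
    using L D L'(1) unfolding R_symbol_def by (meson mult_carrier_mat)
  have R_eq: "R_symbol p r lam w = (inverse w - 1) \<cdot>\<^sub>m 1\<^sub>m (2 * r) + R_symbol p r lam 1" for w
  proof -
    have 1: "Delta_symbol r lam w = (inverse w - 1) \<cdot>\<^sub>m 1\<^sub>m (2 * r) + Delta_symbol r lam 1"
      by (auto simp: Delta_symbol_def)
    have 2: "?L * ((inverse w - 1) \<cdot>\<^sub>m 1\<^sub>m (2 * r)) = (inverse w - 1) \<cdot>\<^sub>m ?L"
      using mult_smult_distrib[OF L one_carrier_mat] L by simp
    have 3: "?L * Delta_symbol r lam w =
        (inverse w - 1) \<cdot>\<^sub>m ?L + ?L * Delta_symbol r lam 1"
      unfolding 1 2[symmetric] using L D[of 1] by (intro mult_add_distrib_mat) auto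
    have 4: "?L * Delta_symbol r lam w * ?L' =
        (inverse w - 1) \<cdot>\<^sub>m ?L * ?L' + ?L * Delta_symbol r lam 1 * ?L'"
      unfolding 3 using L D[of 1] L'(1)
      by (intro add_mult_distrib_mat[where nr = "2 * r" and n = "2 * r" and nc = "2 * r"]) auto
    show ?thesis unfolding R_symbol_def 4
      using mult_smult_assoc_mat[OF L L'(1), of "inverse w - 1"] L'(2) by simp
  qed
  have H: "H_symbol p r lam w \<in> carrier_mat (p + 2 * r + 1) (p + 2 * r + 1)" for w
    using four_block_carrier_mat[OF T[of w] R[of w], of "Q_mat p r lam" "0\<^sub>m (2 * r) (p + 1)"]
    by (simp add: H_symbol_def add_ac)
  show "H_const p r lam \<in> carrier_mat (p + 2 * r + 1) (p + 2 * r + 1)"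
    using H[of 1] unfolding H_const_def by (simp add: minus_carrier_mat)
  show "H_symbol p r lam z = inverse z \<cdot>\<^sub>m 1\<^sub>m (p + 2 * r + 1) + H_const p r lam"
  proof (rule eq_matI)
    fix i j assume "i < dim_row (inverse z \<cdot>\<^sub>m 1\<^sub>m (p + 2 * r + 1) + H_const p r lam)"
      "j < dim_col (inverse z \<cdot>\<^sub>m 1\<^sub>m (p + 2 * r + 1) + H_const p r lam)"
    hence ij: "i < p + 1 + 2 * r" "j < p + 1 + 2 * r"
      by (auto simp: H_const_def)
    have e: "H_symbol p r lam w $$ (i, j) =
        (if i < p + 1 then if j < p + 1 then T_symbol p w $$ (i, j)
           else Q_mat p r lam $$ (i, j - (p + 1))
         else if j < p + 1 then 0 else R_symbol p r lam w $$ (i - (p + 1), j - (p + 1)))" for w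
      using ij T[of w] R[of w] Q by (auto simp: H_symbol_def)
    have Re: "R_symbol p r lam z $$ (a, b) =
        (inverse z - 1) * (if a = b then 1 else 0) + R_symbol p r lam 1 $$ (a, b)"
      if "a < 2 * r" "b < 2 * r" for a b
      by (subst R_eq) (use that R[of 1] in auto)
    show "H_symbol p r lam z $$ (i, j) =
        (inverse z \<cdot>\<^sub>m 1\<^sub>m (p + 2 * r + 1) + H_const p r lam) $$ (i, j)"
      using ij H[of 1]
      by (auto simp: H_const_def e Re T_symbol_def)
  qed (use H[of z] in \<open>auto simp: H_const_def\<close>)
qed

lemma impulse_response_H_symbol:
  assumes adm: "admissible r lam"
  shows "impulse_response (p + 2 * r + 1) (H_symbol p r lam) =
    (\<lambda>\<alpha>. if \<alpha> = -1 then 1\<^sub>m (p + 2 * r + 1)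
         else if \<alpha> = 0 then H_const p r lam else 0\<^sub>m (p + 2 * r + 1) (p + 2 * r + 1))"
    (is "_ = ?H")
proof (rule impulse_responseI)
  let ?m = "p + 2 * r + 1"
  note C = H_symbol_affine(1)[OF adm, of p]
  have "{\<alpha>. ?H \<alpha> \<noteq> 0\<^sub>m ?m ?m} \<subseteq> {-1, 0}" by auto
  thus "is_mask ?m ?H" using C by (auto simp: is_mask_def intro: finite_subset)
  fix z :: complex assume "z \<noteq> 0"
  show "symbol ?m ?H z = H_symbol p r lam z"
  proof (rule eq_matI)
    fix i j assume "i < dim_row (H_symbol p r lam z)" "j < dim_col (H_symbol p r lam z)"
    hence ij: "i < ?m" "j < ?m" using C by (auto simp: H_symbol_affine(2)[OF adm, of p z])
    have "Sum_any (\<lambda>\<alpha>. ?H \<alpha> $$ (i, j) * z powi \<alpha>) = (\<Sum>\<alpha>\<in>{-1, 0}. ?H \<alpha> $$ (i, j) * z powi \<alpha>)"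
      by (rule Sum_any.expand_superset) (use ij in \<open>auto split: if_splits\<close>)
    thus "symbol ?m ?H z $$ (i, j) = H_symbol p r lam z $$ (i, j)"
      using ij C by (simp add: symbol_def H_symbol_affine(2)[OF adm, of p z] power_int_minus)
  qed (use C in \<open>auto simp: symbol_def H_symbol_affine(2)[OF adm, of p z]\<close>)
qed

end

theory Submission
  imports Defs "HOL-Analysis.Complex_Transcendental"
begin

text \<open>
  The symbol of the annihilating operator is affine in the inverse variable: it equals
  \<open>z\<^sup>-\<^sup>1 I + C\<close> with a constant matrix \<open>C\<close> (\<^const>\<open>H_const\<close>). Hence the factorization asks for a
  finitely supported \<open>B\<close> with
  \<open>B (\<alpha> + 2) + B \<alpha> * C = G \<alpha>\<close>, where \<open>G \<alpha> = A (\<alpha> + 1) + C' * A \<alpha>\<close> is the mask of the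
  annihilating operator of level \<open>n + 1\<close> composed with \<open>A\<close>, and \<open>C\<close>, \<open>C'\<close> belong to the levels
  \<open>n\<close> and \<open>n + 1\<close>. This is a division of \<open>G\<close> from the right by \<open>z\<^sup>-\<^sup>2 I + C\<close>. Starting from zero
  far to the left, the recursion always has exactly one solution \<open>B\<close>; the only question is
  whether \<open>B\<close> vanishes again far to the right.

  The spectral condition decides this. Collect the level-n samples of a basis of the function
  space as the columns of square matrices \<open>W \<beta>\<close> (\<open>jet_mat\<close>). They satisfy two things.

  First, \<open>C * W \<beta> = - W (\<beta> + 1)\<close> (\<open>H_const_mult_jet_mat\<close>): the operator annihilates all samples,
  by Taylor's formula on the polynomials and by the choice of \<open>Q\<close> and \<open>R\<close> on the exponentials.
  Second, \<open>W 0\<close> is nonsingular (\<open>det_jet_mat\<close>): it is block triangular, with a diagonal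
  factorial block and the nonsingular matrix of frequency powers.

  By the recursion, \<open>B (\<alpha> - 2 s) * W s\<close> and \<open>B (\<alpha> - 2 (s + 1)) * W (s + 1)\<close> differ by
  \<open>G (\<alpha> - 2 - 2 s) * W s\<close>. Summing over \<open>s \<ge> 0\<close> telescopes to \<open>B \<alpha> * W 0\<close>. For \<open>\<alpha>\<close> to the right
  of the support of \<open>G\<close> the sum over \<open>s \<ge> 0\<close> is the full subdivision sum of \<open>G\<close> on the samples,
  which is zero: \<open>A\<close> maps samples of level \<open>n\<close> to samples of level \<open>n + 1\<close>, and these are
  annihilated. So \<open>B \<alpha> * W 0 = 0\<close> and \<open>B \<alpha> = 0\<close> (\<open>quotient_mask_vanishes_high\<close>).

  That \<open>B\<close> is real follows once \<open>C\<close> and \<open>C'\<close> are (\<open>H_const_real\<close>): complex conjugation permutes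
  the frequencies, hence the columns of the \<open>W \<beta>\<close>, and \<open>C\<close> is determined by \<open>W 0\<close> and \<open>W 1\<close>.
\<close>

section \<open>Linear calculus of subdivision operators and symbols\<close>

lemma is_mask_carrier: "is_mask m X \<Longrightarrow> X \<alpha> \<in> carrier_mat m m"
  by (simp add: is_mask_def)

lemma is_mask_finite_subdivision:
  assumes X: "is_mask m X" and c: "\<And>\<beta>. c \<beta> \<in> carrier_vec m" and i: "i < m"
  shows "finite {\<beta>. (X (\<alpha> - 2 * \<beta>) *\<^sub>v c \<beta>) $ i \<noteq> 0}"
proof -
  have "finite ((\<lambda>\<beta>. \<alpha> - 2 * \<beta>) -` {\<gamma>. X \<gamma> \<noteq> 0\<^sub>m m m})"
    using X by (intro finite_vimageI) (auto simp: is_mask_def inj_on_def)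
  then show ?thesis
    by (rule rev_finite_subset) (use c i in auto)
qed

lemma is_mask_finite_symbol:
  assumes "is_mask m X" "i < m" "j < m"
  shows "finite {\<alpha>. X \<alpha> $$ (i, j) * z powi \<alpha> \<noteq> (0 :: complex)}"
  by (rule finite_subset[of _ "{\<alpha>. X \<alpha> \<noteq> 0\<^sub>m m m}"]) (use assms in \<open>auto simp: is_mask_def\<close>)

lemma is_mask_shift:
  assumes "is_mask m X"
  shows "is_mask m (\<lambda>\<alpha>. X (\<alpha> + s))"
proof -
  have "finite ((\<lambda>\<alpha>. \<alpha> + s) -` {\<gamma>. X \<gamma> \<noteq> 0\<^sub>m m m})"
    using assms by (intro finite_vimageI) (auto simp: is_mask_def inj_on_def)
  then show ?thesis using assms by (simp add: is_mask_def vimage_def)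
qed

lemma is_mask_mult:
  fixes X :: "int \<Rightarrow> 'a :: semiring_0 mat"
  assumes X: "is_mask m X" and M: "M \<in> carrier_mat m m"
  shows "is_mask m (\<lambda>\<alpha>. M * X \<alpha>)" and "is_mask m (\<lambda>\<alpha>. X \<alpha> * M)"
proof -
  have "{\<alpha>. M * X \<alpha> \<noteq> 0\<^sub>m m m} \<subseteq> {\<alpha>. X \<alpha> \<noteq> 0\<^sub>m m m}"
    "{\<alpha>. X \<alpha> * M \<noteq> 0\<^sub>m m m} \<subseteq> {\<alpha>. X \<alpha> \<noteq> 0\<^sub>m m m}"
    using M by auto
  then show "is_mask m (\<lambda>\<alpha>. M * X \<alpha>)" and "is_mask m (\<lambda>\<alpha>. X \<alpha> * M)"
    using X M by (auto simp: is_mask_def intro: finite_subset mult_carrier_mat[of _ m m])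
qed

lemma is_mask_add:
  fixes X Y :: "int \<Rightarrow> 'a :: monoid_add mat"
  assumes "is_mask m X" "is_mask m Y"
  shows "is_mask m (\<lambda>\<alpha>. X \<alpha> + Y \<alpha>)"
proof -
  have "{\<alpha>. X \<alpha> + Y \<alpha> \<noteq> 0\<^sub>m m m} \<subseteq> {\<alpha>. X \<alpha> \<noteq> 0\<^sub>m m m} \<union> {\<alpha>. Y \<alpha> \<noteq> 0\<^sub>m m m}"
    by auto
  then show ?thesis
    using assms by (auto simp: is_mask_def intro: finite_subset)
qed

lemma is_mask_cmask: "is_mask m X \<Longrightarrow> is_mask m (cmask X)"
  by (auto simp: is_mask_def cmask_def elim!: rev_finite_subset)

lemma subdivision_carrier [simp]: "subdivision m X c \<alpha> \<in> carrier_vec m"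
  by (simp add: subdivision_def)

lemma subdivision_index:
  "i < m \<Longrightarrow> subdivision m X c \<alpha> $ i = Sum_any (\<lambda>\<beta>. (X (\<alpha> - 2 * \<beta>) *\<^sub>v c \<beta>) $ i)"
  by (simp add: subdivision_def)

lemma subdivision_shift_output:
  "subdivision m (\<lambda>\<alpha>. X (\<alpha> + s)) c \<alpha> = subdivision m X c (\<alpha> + s)"
  by (simp add: subdivision_def algebra_simps)

text \<open>
  Shifting a mask by two moves the input by one, because the input index enters the mask
  argument with the factor two. This is what makes \<open>z\<^sup>2\<close> appear on the right of the factorization.
\<close>

lemma subdivision_shift_input:
  "subdivision m (\<lambda>\<alpha>. X (\<alpha> + 2)) c \<alpha> = subdivision m X (\<lambda>\<beta>. c (\<beta> + 1)) \<alpha>"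
proof -
  have "Sum_any (\<lambda>\<beta>. (X (\<alpha> - 2 * \<beta> + 2) *\<^sub>v c \<beta>) $ i) =
      Sum_any (\<lambda>\<beta>. (X (\<alpha> - 2 * \<beta>) *\<^sub>v c (\<beta> + 1)) $ i)" for i
    by (rule Sum_any.reindex_cong[of "\<lambda>\<beta>. \<beta> + 1"])
       (auto simp: fun_eq_iff algebra_simps bij_plus_right)
  then show ?thesis by (simp add: subdivision_def)
qed

lemma subdivision_add_mask:
  assumes X: "is_mask m X" and Y: "is_mask m Y" and c: "\<And>\<beta>. c \<beta> \<in> carrier_vec m"
  shows "subdivision m (\<lambda>\<alpha>. X \<alpha> + Y \<alpha>) c \<alpha> = subdivision m X c \<alpha> + subdivision m Y c \<alpha>"
proof (rule eq_vecI)
  fix i assume "i < dim_vec (subdivision m X c \<alpha> + subdivision m Y c \<alpha>)"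
  then have i: "i < m" by (simp add: subdivision_def)
  have "((X \<gamma> + Y \<gamma>) *\<^sub>v c \<beta>) $ i = (X \<gamma> *\<^sub>v c \<beta>) $ i + (Y \<gamma> *\<^sub>v c \<beta>) $ i" for \<gamma> \<beta>
    using i is_mask_carrier[OF X, of \<gamma>] is_mask_carrier[OF Y, of \<gamma>] c[of \<beta>]
    by (subst add_mult_distrib_mat_vec[of _ m m]) auto
  then show "subdivision m (\<lambda>\<alpha>. X \<alpha> + Y \<alpha>) c \<alpha> $ i = (subdivision m X c \<alpha> + subdivision m Y c \<alpha>) $ i"
    using i Sum_any.distrib[OF is_mask_finite_subdivision[OF X c i] is_mask_finite_subdivision[OF Y c i]]
    by (simp add: subdivision_index carrier_vecD[OF subdivision_carrier])
qed (simp add: subdivision_def)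

lemma subdivision_add_arg:
  assumes X: "is_mask m X" and c: "\<And>\<beta>. c \<beta> \<in> carrier_vec m" "\<And>\<beta>. d \<beta> \<in> carrier_vec m"
  shows "subdivision m X (\<lambda>\<beta>. c \<beta> + d \<beta>) \<alpha> = subdivision m X c \<alpha> + subdivision m X d \<alpha>"
proof (rule eq_vecI)
  fix i assume "i < dim_vec (subdivision m X c \<alpha> + subdivision m X d \<alpha>)"
  then have i: "i < m" by (simp add: subdivision_def)
  have "(X \<gamma> *\<^sub>v (c \<beta> + d \<beta>)) $ i = (X \<gamma> *\<^sub>v c \<beta>) $ i + (X \<gamma> *\<^sub>v d \<beta>) $ i" for \<gamma> \<beta>
    using i is_mask_carrier[OF X, of \<gamma>] c[of \<beta>]
    by (subst mult_add_distrib_mat_vec[of _ m m]) auto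
  then show "subdivision m X (\<lambda>\<beta>. c \<beta> + d \<beta>) \<alpha> $ i = (subdivision m X c \<alpha> + subdivision m X d \<alpha>) $ i"
    using i Sum_any.distrib[OF is_mask_finite_subdivision[OF X c(1) i] is_mask_finite_subdivision[OF X c(2) i]]
    by (simp add: subdivision_index carrier_vecD[OF subdivision_carrier])
qed (simp add: subdivision_def)

lemma Sum_any_sum_swap:
  fixes f :: "'a \<Rightarrow> 'b \<Rightarrow> 'c :: comm_monoid_add"
  assumes "finite S" "\<And>l. l \<in> S \<Longrightarrow> finite {a. f a l \<noteq> 0}"
  shows "Sum_any (\<lambda>a. \<Sum>l\<in>S. f a l) = (\<Sum>l\<in>S. Sum_any (\<lambda>a. f a l))"
  using assms
proof (induction S rule: finite_induct)
  case (insert l S)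
  have "finite {a. (\<Sum>l\<in>S. f a l) \<noteq> 0}"
    by (rule finite_subset[of _ "\<Union>l\<in>S. {a. f a l \<noteq> 0}"])
       (use insert in \<open>auto elim: sum.not_neutral_contains_not_neutral\<close>)
  then show ?case using insert by (simp add: Sum_any.distrib)
qed simp

lemma subdivision_mult_left:
  assumes X: "is_mask m X" and M: "M \<in> carrier_mat m m" and c: "\<And>\<beta>. c \<beta> \<in> carrier_vec m"
  shows "subdivision m (\<lambda>\<alpha>. M * X \<alpha>) c \<alpha> = M *\<^sub>v subdivision m X c \<alpha>"
proof (rule eq_vecI)
  fix i assume "i < dim_vec (M *\<^sub>v subdivision m X c \<alpha>)"
  then have i: "i < m" using M by simp
  note fin = is_mask_finite_subdivision[OF X c]
  have "((M * X \<gamma>) *\<^sub>v c \<beta>) $ i = (\<Sum>l = 0..<m. M $$ (i, l) * (X \<gamma> *\<^sub>v c \<beta>) $ l)" for \<gamma> \<beta>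
  proof -
    have "(M * X \<gamma>) *\<^sub>v c \<beta> = M *\<^sub>v (X \<gamma> *\<^sub>v c \<beta>)"
      using assoc_mult_mat_vec[OF M is_mask_carrier[OF X] c] .
    moreover have "dim_vec (X \<gamma> *\<^sub>v c \<beta>) = m" using is_mask_carrier[OF X, of \<gamma>] by simp
    ultimately show ?thesis using i M by (simp add: scalar_prod_def)
  qed
  then have "subdivision m (\<lambda>\<alpha>. M * X \<alpha>) c \<alpha> $ i =
      Sum_any (\<lambda>\<beta>. \<Sum>l = 0..<m. M $$ (i, l) * (X (\<alpha> - 2 * \<beta>) *\<^sub>v c \<beta>) $ l)"
    using i by (simp add: subdivision_index)
  also have "\<dots> = (\<Sum>l = 0..<m. Sum_any (\<lambda>\<beta>. M $$ (i, l) * (X (\<alpha> - 2 * \<beta>) *\<^sub>v c \<beta>) $ l))"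
    by (rule Sum_any_sum_swap, simp, rule finite_subset[OF _ fin]) auto
  also have "\<dots> = (\<Sum>l = 0..<m. M $$ (i, l) * subdivision m X c \<alpha> $ l)"
    by (intro sum.cong refl) (simp add: subdivision_index Sum_any_right_distrib[OF fin])
  also have "\<dots> = (M *\<^sub>v subdivision m X c \<alpha>) $ i"
    using i M by (simp add: scalar_prod_def carrier_vecD[OF subdivision_carrier])
  finally show "subdivision m (\<lambda>\<alpha>. M * X \<alpha>) c \<alpha> $ i = (M *\<^sub>v subdivision m X c \<alpha>) $ i" .
qed (use M in \<open>simp add: subdivision_def\<close>)

lemma subdivision_mult_right:
  assumes X: "is_mask m X" and M: "M \<in> carrier_mat m m" and c: "\<And>\<beta>. c \<beta> \<in> carrier_vec m"
  shows "subdivision m (\<lambda>\<alpha>. X \<alpha> * M) c \<alpha> = subdivision m X (\<lambda>\<beta>. M *\<^sub>v c \<beta>) \<alpha>"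
  by (simp add: subdivision_def assoc_mult_mat_vec[OF is_mask_carrier[OF X] M c])

lemma symbol_carrier [simp]: "symbol m X z \<in> carrier_mat m m"
  by (simp add: symbol_def)

lemma symbol_shift:
  assumes X: "is_mask m X" and z: "z \<noteq> 0"
  shows "symbol m (\<lambda>\<alpha>. X (\<alpha> + s)) z = z powi (- s) \<cdot>\<^sub>m symbol m X z"
proof (rule eq_matI)
  fix i j assume "i < dim_row (z powi (- s) \<cdot>\<^sub>m symbol m X z)" "j < dim_col (z powi (- s) \<cdot>\<^sub>m symbol m X z)"
  then have ij: "i < m" "j < m" by (simp_all add: symbol_def)
  have "Sum_any (\<lambda>\<alpha>. X (\<alpha> + s) $$ (i, j) * z powi \<alpha>) =
      Sum_any (\<lambda>\<alpha>. z powi (- s) * (X \<alpha> $$ (i, j) * z powi \<alpha>))"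
    by (rule Sum_any.reindex_cong[of "\<lambda>\<alpha>. \<alpha> - s"])
       (auto simp: fun_eq_iff bij_diff_right power_int_diff power_int_minus z field_simps)
  then show "symbol m (\<lambda>\<alpha>. X (\<alpha> + s)) z $$ (i, j) = (z powi (- s) \<cdot>\<^sub>m symbol m X z) $$ (i, j)"
    using ij Sum_any_right_distrib[OF is_mask_finite_symbol[OF X ij]] by (simp add: symbol_def)
qed (simp_all add: symbol_def)

lemma symbol_add:
  assumes X: "is_mask m X" and Y: "is_mask m Y"
  shows "symbol m (\<lambda>\<alpha>. X \<alpha> + Y \<alpha>) z = symbol m X z + symbol m Y z"
proof (rule eq_matI)
  fix i j assume "i < dim_row (symbol m X z + symbol m Y z)" "j < dim_col (symbol m X z + symbol m Y z)"
  then have ij: "i < m" "j < m" by (simp_all add: symbol_def)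
  have "(X \<alpha> + Y \<alpha>) $$ (i, j) = X \<alpha> $$ (i, j) + Y \<alpha> $$ (i, j)" for \<alpha>
    using is_mask_carrier[OF X, of \<alpha>] is_mask_carrier[OF Y, of \<alpha>] ij by simp
  then show "symbol m (\<lambda>\<alpha>. X \<alpha> + Y \<alpha>) z $$ (i, j) = (symbol m X z + symbol m Y z) $$ (i, j)"
    using ij Sum_any.distrib[OF is_mask_finite_symbol[OF X ij] is_mask_finite_symbol[OF Y ij]]
    by (simp add: symbol_def distrib_right)
qed (simp_all add: symbol_def)

lemma symbol_mult_left:
  assumes X: "is_mask m X" and M: "M \<in> carrier_mat m m"
  shows "symbol m (\<lambda>\<alpha>. M * X \<alpha>) z = M * symbol m X z"
proof (rule eq_matI)
  fix i j assume "i < dim_row (M * symbol m X z)" "j < dim_col (M * symbol m X z)"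
  then have ij: "i < m" "j < m" using M by (simp_all add: symbol_def)
  note fin = is_mask_finite_symbol[OF X]
  have "symbol m (\<lambda>\<alpha>. M * X \<alpha>) z $$ (i, j) =
      Sum_any (\<lambda>\<alpha>. \<Sum>l = 0..<m. M $$ (i, l) * (X \<alpha> $$ (l, j) * z powi \<alpha>))"
  proof -
    have "(M * X \<alpha>) $$ (i, j) * z powi \<alpha> = (\<Sum>l = 0..<m. M $$ (i, l) * (X \<alpha> $$ (l, j) * z powi \<alpha>))" for \<alpha>
      using is_mask_carrier[OF X, of \<alpha>] M ij by (simp add: scalar_prod_def sum_distrib_right mult.assoc)
    then show ?thesis using ij by (simp add: symbol_def)
  qed
  also have "\<dots> = (\<Sum>l = 0..<m. Sum_any (\<lambda>\<alpha>. M $$ (i, l) * (X \<alpha> $$ (l, j) * z powi \<alpha>)))"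
    using ij by (intro Sum_any_sum_swap) (auto intro: finite_subset[OF _ fin[of _ j z]])
  also have "\<dots> = (\<Sum>l = 0..<m. M $$ (i, l) * symbol m X z $$ (l, j))"
    using ij by (intro sum.cong refl) (simp add: symbol_def Sum_any_right_distrib[OF fin])
  also have "\<dots> = (M * symbol m X z) $$ (i, j)"
    using M ij by (simp add: scalar_prod_def symbol_def)
  finally show "symbol m (\<lambda>\<alpha>. M * X \<alpha>) z $$ (i, j) = (M * symbol m X z) $$ (i, j)" .
qed (use M in \<open>simp_all add: symbol_def\<close>)

lemma symbol_mult_right:
  assumes X: "is_mask m X" and M: "M \<in> carrier_mat m m"
  shows "symbol m (\<lambda>\<alpha>. X \<alpha> * M) z = symbol m X z * M"
proof (rule eq_matI)
  fix i j assume "i < dim_row (symbol m X z * M)" "j < dim_col (symbol m X z * M)"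
  then have ij: "i < m" "j < m" using M by (simp_all add: symbol_def)
  note fin = is_mask_finite_symbol[OF X]
  have "symbol m (\<lambda>\<alpha>. X \<alpha> * M) z $$ (i, j) =
      Sum_any (\<lambda>\<alpha>. \<Sum>l = 0..<m. X \<alpha> $$ (i, l) * z powi \<alpha> * M $$ (l, j))"
  proof -
    have "(X \<alpha> * M) $$ (i, j) * z powi \<alpha> = (\<Sum>l = 0..<m. X \<alpha> $$ (i, l) * z powi \<alpha> * M $$ (l, j))" for \<alpha>
      using is_mask_carrier[OF X, of \<alpha>] M ij by (simp add: scalar_prod_def sum_distrib_left sum_distrib_right mult_ac)
    then show ?thesis using ij by (simp add: symbol_def)
  qed
  also have "\<dots> = (\<Sum>l = 0..<m. Sum_any (\<lambda>\<alpha>. X \<alpha> $$ (i, l) * z powi \<alpha> * M $$ (l, j)))"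
    using ij by (intro Sum_any_sum_swap) (auto intro: finite_subset[OF _ fin[of i _ z]])
  also have "\<dots> = (\<Sum>l = 0..<m. symbol m X z $$ (i, l) * M $$ (l, j))"
    using ij by (intro sum.cong refl) (simp add: symbol_def Sum_any_left_distrib[OF fin])
  also have "\<dots> = (symbol m X z * M) $$ (i, j)"
    using M ij by (simp add: scalar_prod_def symbol_def)
  finally show "symbol m (\<lambda>\<alpha>. X \<alpha> * M) z $$ (i, j) = (symbol m X z * M) $$ (i, j)" .
qed (use M in \<open>simp_all add: symbol_def\<close>)

section \<open>Right division by a first order symbol\<close>

text \<open>
  The quotient of \<open>G\<close> by \<open>z\<^sup>-\<^sup>2 I + C\<close> from the right, expanded as a series that starts at the
  index \<open>a\<close>. The even and the odd indices are computed independently.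
\<close>

function right_quotient ::
  "nat \<Rightarrow> int \<Rightarrow> (int \<Rightarrow> 'a :: ring mat) \<Rightarrow> 'a mat \<Rightarrow> int \<Rightarrow> 'a mat" where
  "right_quotient m a G C \<alpha> = (if \<alpha> < a then 0\<^sub>m m m
     else G (\<alpha> - 2) - right_quotient m a G C (\<alpha> - 2) * C)"
  by auto
termination by (relation "measure (\<lambda>(m, a, G, C, \<alpha>). nat (\<alpha> - a + 2))") auto

declare right_quotient.simps [simp del]

lemma right_quotient_carrier:
  assumes G: "\<And>\<alpha>. G \<alpha> \<in> carrier_mat m m" and C: "C \<in> carrier_mat m m"
  shows "right_quotient m a G C \<alpha> \<in> carrier_mat m m"
  using assms
  by (induction m a G C \<alpha> rule: right_quotient.induct)
     (subst right_quotient.simps, auto intro!: minus_carrier_mat mult_carrier_mat)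

lemma right_quotient_step:
  assumes G: "\<And>\<alpha>. G \<alpha> \<in> carrier_mat m m" and C: "C \<in> carrier_mat m m"
    and low: "\<And>\<alpha>. \<alpha> < a \<Longrightarrow> G \<alpha> = 0\<^sub>m m m"
  shows "right_quotient m a G C (\<alpha> + 2) + right_quotient m a G C \<alpha> * C = G \<alpha>"
proof -
  let ?B = "right_quotient m a G C"
  note B = right_quotient_carrier[of G, OF G C]
  show ?thesis
  proof (cases "\<alpha> + 2 < a")
    case True
    then show ?thesis using C low by (simp add: right_quotient.simps)
  next
    case False
    then have "?B (\<alpha> + 2) = G \<alpha> - ?B \<alpha> * C" by (subst right_quotient.simps) simp
    then show ?thesis using G[of \<alpha>] B[of a \<alpha>] C by (auto intro!: eq_matI)
  qed
qed

lemma mat_eq_0_if_mult_nonsingular: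
  fixes X W :: "'a :: field mat"
  assumes X: "X \<in> carrier_mat k n" and W: "W \<in> carrier_mat n n" and "det W \<noteq> 0"
    and XW: "X * W = 0\<^sub>m k n"
  shows "X = 0\<^sub>m k n"
proof -
  obtain V where V: "V \<in> carrier_mat n n" "W * V = 1\<^sub>m n"
    using det_non_zero_imp_unit[OF W \<open>det W \<noteq> 0\<close>] unfolding Units_def ring_mat_def by auto
  have "X = X * W * V" using X W V by (simp add: assoc_mult_mat[OF X W V(1)])
  then show ?thesis using XW V by simp
qed

text \<open>
  The quotient is a Laurent polynomial as soon as the dividend annihilates every solution \<open>W\<close> of the
  homogeneous recursion belonging to the divisor, provided these solutions span all initial
  values. It plays the role of the remainder theorem for matrix polynomials; the
  telescoping argument evaluates the remainder without inverting \<open>C\<close>.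
\<close>

lemma quotient_mask_vanishes_high:
  fixes B G W :: "int \<Rightarrow> 'a :: field mat"
  assumes B: "\<And>\<alpha>. B \<alpha> \<in> carrier_mat m m" and C: "C \<in> carrier_mat m m"
    and W: "\<And>\<alpha>. W \<alpha> \<in> carrier_mat m m"
    and step: "\<And>\<alpha>. B (\<alpha> + 2) + B \<alpha> * C = G \<alpha>"
    and low: "\<And>\<alpha>. \<alpha> < a \<Longrightarrow> B \<alpha> = 0\<^sub>m m m"
    and high: "\<And>\<alpha>. b < \<alpha> \<Longrightarrow> G \<alpha> = 0\<^sub>m m m"
    and W_step: "\<And>\<beta>. C * W \<beta> = - W (\<beta> + 1)"
    and det: "det (W 0) \<noteq> 0"
    and annihilates: "\<And>\<alpha> i j. \<lbrakk>i < m; j < m\<rbrakk> \<Longrightarrow> Sum_any (\<lambda>\<beta>. (G (\<alpha> - 2 * \<beta>) * W \<beta>) $$ (i, j)) = 0"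
    and "b < \<alpha>"
  shows "B \<alpha> = 0\<^sub>m m m"
proof (rule mat_eq_0_if_mult_nonsingular[OF B W det], rule eq_matI)
  fix i j assume "i < dim_row (0\<^sub>m m m :: 'a mat)" "j < dim_col (0\<^sub>m m m :: 'a mat)"
  then have ij: "i < m" "j < m" by simp_all
  define \<Phi> where "\<Phi> s = (B (\<alpha> - 2 * int s) * W (int s)) $$ (i, j)" for s
  have G: "G \<gamma> \<in> carrier_mat m m" for \<gamma> by (metis step add_carrier_mat mult_carrier_mat B C)
  have diff: "(G (\<alpha> - 2 - 2 * int s) * W (int s)) $$ (i, j) = \<Phi> s - \<Phi> (Suc s)" for s
  proof -
    define \<gamma> where "\<gamma> = \<alpha> - 2 - 2 * int s"
    have "G \<gamma> * W (int s) = B (\<gamma> + 2) * W (int s) + B \<gamma> * (C * W (int s))"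
      using assoc_mult_mat[OF B C W] 
      by (simp add: step[symmetric] add_mult_distrib_mat[OF B mult_carrier_mat[OF B C] W])
    also have "B \<gamma> * (C * W (int s)) = - (B \<gamma> * W (int s + 1))"
      unfolding W_step using B[of \<gamma>] W[of "int s + 1"] by simp
    finally show ?thesis
      using ij B[of \<gamma>] W[of "int s + 1"] B[of "\<gamma> + 2"] W[of "int s"] by (simp add: \<Phi>_def \<gamma>_def algebra_simps)
  qed
  \<comment> \<open>Steps of two bring the index of \<open>B\<close> below \<open>a\<close> after at most this many steps.\<close>
  define M where "M = nat (\<alpha> - a) + 1"
  have "(0 :: 'a) = Sum_any (\<lambda>\<beta>. (G (\<alpha> - 2 - 2 * \<beta>) * W \<beta>) $$ (i, j))"
    using annihilates[OF ij] by simp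
  also have "\<dots> = (\<Sum>\<beta>\<in>int ` {..<M}. (G (\<alpha> - 2 - 2 * \<beta>) * W \<beta>) $$ (i, j))"
  proof (rule Sum_any.expand_superset)
    have "\<beta> \<in> int ` {..<M}" if nz: "(G (\<alpha> - 2 - 2 * \<beta>) * W \<beta>) $$ (i, j) \<noteq> 0" for \<beta>
    proof -
      have "G (\<alpha> - 2 - 2 * \<beta>) \<noteq> 0\<^sub>m m m" using nz ij W[of \<beta>] by auto
      \<comment> \<open>To the left of \<open>a\<close>, both terms that make up \<open>G\<close> in the recursion are zero.\<close>
      then have "\<not> b < \<alpha> - 2 - 2 * \<beta>" "\<not> \<alpha> - 2 * \<beta> < a"
        using high[of "\<alpha> - 2 - 2 * \<beta>"] low[of "\<alpha> - 2 * \<beta>"] low[of "\<alpha> - 2 - 2 * \<beta>"] C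
          step[of "\<alpha> - 2 - 2 * \<beta>"] by auto
      then have "0 \<le> \<beta>" "nat \<beta> < M" using \<open>b < \<alpha>\<close> by (auto simp: M_def)
      then show ?thesis by (intro image_eqI[of _ _ "nat \<beta>"]) auto
    qed
    then show "{\<beta>. (G (\<alpha> - 2 - 2 * \<beta>) * W \<beta>) $$ (i, j) \<noteq> 0} \<subseteq> int ` {..<M}" by blast
  qed simp
  also have "\<dots> = (\<Sum>s<M. \<Phi> s - \<Phi> (Suc s))"
    by (simp add: sum.reindex diff)
  also have "\<dots> = \<Phi> 0 - \<Phi> M" by (rule sum_lessThan_telescope')
  also have "\<Phi> M = 0"
    using low[of "\<alpha> - 2 * int M"] ij W[of "int M"] by (simp add: \<Phi>_def M_def)
  finally show "(B \<alpha> * W 0) $$ (i, j) = 0\<^sub>m m m $$ (i, j)" using ij by (simp add: \<Phi>_def)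
qed (use B W in auto)

section \<open>Hermite samples of the function space\<close>

lemma nth_deriv_exp:
  "nth_deriv k (\<lambda>x. exp (\<mu> * complex_of_real x)) = (\<lambda>x. \<mu> ^ k * exp (\<mu> * complex_of_real x))"
proof (induction k)
  case (Suc k)
  have "((\<lambda>x. \<mu> ^ k * exp (\<mu> * complex_of_real x)) has_vector_derivative
      \<mu> ^ Suc k * exp (\<mu> * complex_of_real x)) (at x)" for x
    by (rule has_vector_derivative_real_field) (auto intro!: derivative_eq_intros simp: mult_ac)
  then show ?case
    using Suc by (auto simp: nth_deriv_def intro!: vector_derivative_at)
qed (simp add: nth_deriv_def)

lemma nth_deriv_power:
  "nth_deriv k (\<lambda>x. complex_of_real x ^ j) =
    (\<lambda>x. if k \<le> j then fact j / fact (j - k) * complex_of_real x ^ (j - k) else 0)"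
proof (induction k)
  case (Suc k)
  have "((\<lambda>x. if k \<le> j then fact j / fact (j - k) * complex_of_real x ^ (j - k) else 0)
      has_vector_derivative
      (if Suc k \<le> j then fact j / fact (j - Suc k) * complex_of_real x ^ (j - Suc k) else 0)) (at x)" for x
  proof (cases "Suc k \<le> j")
    case True
    then obtain l where l: "j - k = Suc l" "j - Suc k = l"
      by (metis Suc_diff_Suc Suc_le_lessD)
    have "((\<lambda>x. complex_of_real x ^ Suc l) has_vector_derivative of_nat (Suc l) * complex_of_real x ^ l) (at x)"
      by (rule has_vector_derivative_real_field)
        (auto intro!: derivative_eq_intros simp del: power_Suc)
    from has_vector_derivative_mult_right[OF this, of "fact j / fact (Suc l)"]
    have "((\<lambda>x. fact j / fact (Suc l) * complex_of_real x ^ Suc l) has_vector_derivative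
        fact j / fact l * complex_of_real x ^ l) (at x)"
      by (simp add: field_simps del: power_Suc of_nat_Suc)
    then show ?thesis using True l by simp
  next
    case False
    then show ?thesis by (cases "k = j") auto
  qed
  then show ?case
    using Suc by (auto simp: nth_deriv_def intro!: vector_derivative_at)
qed (simp add: nth_deriv_def)

definition basis_fun :: "nat \<Rightarrow> (nat \<Rightarrow> complex) \<Rightarrow> nat \<Rightarrow> real \<Rightarrow> complex" where
  "basis_fun p lam j = (if j \<le> p then (\<lambda>x. complex_of_real x ^ j)
     else (\<lambda>x. exp (freq lam (j - (p + 1)) * complex_of_real x)))"

lemma basis_fun_in_V_space:
  assumes "j < p + 2 * r + 1"
  shows "basis_fun p lam j \<in> V_space p r lam"
proof (cases "j \<le> p")
  case True
  let ?a = "\<lambda>k. if k = j then 1 else 0 :: complex"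
  have "basis_fun p lam j = (\<lambda>x. (\<Sum>k\<le>p. ?a k * complex_of_real x ^ k) +
      (\<Sum>l<r. 0 * exp (lam l * complex_of_real x) + 0 * exp (- lam l * complex_of_real x)))"
    using True by (simp add: basis_fun_def if_distrib[of "\<lambda>u. u * _"] cong: if_cong)
  then show ?thesis unfolding V_space_def mem_Collect_eq
    by (intro exI[of _ ?a] exI[of _ "\<lambda>_. 0"])
next
  case False
  define c where "c = j - (p + 1)"
  have c: "c div 2 < r" using assms False by (auto simp: c_def)
  let ?b = "\<lambda>l. if l = c div 2 \<and> even c then 1 else 0 :: complex"
  let ?c = "\<lambda>l. if l = c div 2 \<and> odd c then 1 else 0 :: complex"
  have "(\<Sum>l<r. ?b l * exp (lam l * complex_of_real x) + ?c l * exp (- lam l * complex_of_real x))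
      = (\<Sum>l<r. if l = c div 2 then exp (freq lam c * complex_of_real x) else 0)" for x
    by (rule sum.cong) (auto simp: freq_def)
  then have "basis_fun p lam j = (\<lambda>x. (\<Sum>k\<le>p. 0 * complex_of_real x ^ k) +
      (\<Sum>l<r. ?b l * exp (lam l * complex_of_real x) + ?c l * exp (- lam l * complex_of_real x)))"
    using False c by (simp add: basis_fun_def c_def)
  then show ?thesis unfolding V_space_def mem_Collect_eq
    by (intro exI[of _ ?b] exI[of _ ?c] exI[of _ "\<lambda>_. 0"])
qed

text \<open>
  The columns are the samples of the basis functions, so at one point this is their
  Wronskian matrix with rows scaled by powers of the mesh width.
\<close>

definition jet_mat :: "nat \<Rightarrow> nat \<Rightarrow> (nat \<Rightarrow> complex) \<Rightarrow> nat \<Rightarrow> int \<Rightarrow> complex mat" where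
  "jet_mat p r lam n \<alpha> = mat (p + 2 * r + 1) (p + 2 * r + 1)
     (\<lambda>(k, j). hermite_seq (p + 2 * r) (basis_fun p lam j) n \<alpha> $ k)"

lemma jet_mat_carrier:
  "jet_mat p r lam n \<alpha> \<in> carrier_mat (p + 2 * r + 1) (p + 2 * r + 1)"
  by (simp add: jet_mat_def)

lemma freq_scaled: "freq (scaled n lam) c = freq lam c / 2 ^ n"
  by (simp add: freq_def scaled_def)

text \<open>
  Sampling at level \<open>n\<close> is sampling of the dilated function at the integers. A monomial is
  only multiplied by a constant under dilation, and in an exponential the frequency is
  replaced by its scaled version, which is why the samples fit the operator with scaled
  frequencies.
\<close>

lemma jet_mat_polynomial:
  assumes "k < p + 2 * r + 1" "j \<le> p"
  shows "jet_mat p r lam n \<alpha> $$ (k, j) =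
    (if k \<le> j then (1 / 2) ^ (n * j) * (fact j / fact (j - k)) * of_int \<alpha> ^ (j - k) else 0)"
proof -
  have "(1 / 2) ^ (n * k) * (of_int \<alpha> / 2 ^ n) ^ (j - k) =
      (1 / 2 :: complex) ^ (n * j) * of_int \<alpha> ^ (j - k)" if "k \<le> j"
  proof -
    have "(1 / 2) ^ (n * j) = (1 / 2 :: complex) ^ (n * k) * (1 / 2) ^ (n * (j - k))"
      using that by (simp add: power_add[symmetric] diff_mult_distrib2)
    then show ?thesis by (simp add: power_divide power_mult power_one_over)
  qed
  then show ?thesis
    using assms by (simp add: jet_mat_def hermite_seq_def basis_fun_def nth_deriv_power mult_ac)
qed

lemma jet_mat_exponential:
  fixes lam :: "nat \<Rightarrow> complex" and n :: nat
  assumes "k < p + 2 * r + 1" "c < 2 * r"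
  defines "\<mu> \<equiv> freq (scaled n lam) c"
  shows "jet_mat p r lam n \<alpha> $$ (k, p + 1 + c) = \<mu> ^ k * exp (\<mu> * of_int \<alpha>)"
  using assms
  by (simp add: jet_mat_def hermite_seq_def basis_fun_def nth_deriv_exp freq_scaled power_divide
      power_mult power_one_over)

lemma upper_index:
  fixes j p r :: nat
  assumes "\<not> j \<le> p" "j < p + 2 * r + 1"
  obtains c where "j = p + 1 + c" "c < 2 * r"
  by (rule that[of "j - (p + 1)"]) (use assms in auto)

text \<open>
  At the origin the derivatives of a monomial vanish except one, so the polynomial columns
  form a diagonal block with zeros below it; the remaining diagonal block is the matrix of
  frequency powers.
\<close>

lemma det_jet_mat:
  assumes "admissible r lam"
  shows "det (jet_mat p r lam n 0) \<noteq> 0"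
proof -
  let ?mu = "freq (scaled n lam)"
  define U where "U = mat (p + 1) (p + 1) (\<lambda>(k, j). if k = j then (1 / 2) ^ (n * j) * fact j else 0 :: complex)"
  define X where "X = mat (p + 1) (2 * r) (\<lambda>(k, c). ?mu c ^ k)"
  let ?L = "L_mat p r (scaled n lam)"
  have "jet_mat p r lam n 0 = four_block_mat U X (0\<^sub>m (2 * r) (p + 1)) ?L"
  proof (rule eq_matI)
    fix k j
    assume "k < dim_row (four_block_mat U X (0\<^sub>m (2 * r) (p + 1)) ?L)"
      "j < dim_col (four_block_mat U X (0\<^sub>m (2 * r) (p + 1)) ?L)"
    then have kj: "k < p + 2 * r + 1" "j < p + 2 * r + 1"
      by (auto simp: U_def L_mat_def)
    show "jet_mat p r lam n 0 $$ (k, j) = four_block_mat U X (0\<^sub>m (2 * r) (p + 1)) ?L $$ (k, j)"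
    proof (cases "j \<le> p")
      case True
      then show ?thesis using kj
        by (auto simp: jet_mat_polynomial U_def L_mat_def X_def)
    next
      case False
      then obtain c where c: "j = p + 1 + c" "c < 2 * r"
    using kj upper_index by blast
      show ?thesis
        using jet_mat_exponential[OF kj(1) c(2), of lam n 0] kj c
        by (auto simp: U_def L_mat_def X_def power_add[symmetric] power_Suc[symmetric] simp del: power_Suc)
    qed
  qed (auto simp: jet_mat_def U_def L_mat_def)
  moreover have "det U \<noteq> 0"
    by (subst det_upper_triangular[of _ "p + 1"]) (auto simp: U_def diag_mat_def prod_list_zero_iff intro!: upper_triangularI)
  moreover have "det ?L \<noteq> 0" using L_mat_det[OF admissible_scaled[OF assms]] .
  ultimately show ?thesis
    by (simp add: det_four_block_mat_lower_left_zero[of _ "p + 1" _ "2 * r"] U_def X_def L_mat_def)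
qed

section \<open>The annihilating operator on samples\<close>

lemma sum_split_blocks:
  "(\<Sum>l = 0..<p + 2 * r + 1. f l) = (\<Sum>l\<le>p. f l) + (\<Sum>c<2 * r. f (p + 1 + c))"
  for f :: "nat \<Rightarrow> 'a :: comm_monoid_add"
proof -
  have "(\<Sum>l = 0..<p + 2 * r + 1. f l) = (\<Sum>l = 0..<p + 1. f l) + (\<Sum>l = p + 1..<p + 2 * r + 1. f l)"
    by (intro sum.atLeastLessThan_concat[symmetric]) auto
  also have "(\<Sum>l = p + 1..<p + 2 * r + 1. f l) = (\<Sum>c<2 * r. f (p + 1 + c))"
    by (rule sum.reindex_bij_witness[of _ "\<lambda>c. p + 1 + c" "\<lambda>l. l - (p + 1)"]) auto
  also have "{0..<p + 1} = {..p}" by auto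
  finally show ?thesis .
qed

lemma sum_upper_part:
  "(\<Sum>l\<le>p. if k \<le> l then g l else 0) = (\<Sum>i\<le>p - k. g (k + i))" if "k \<le> p"
  for g :: "nat \<Rightarrow> 'a :: comm_monoid_add"
proof -
  have "(\<Sum>l\<le>p. if k \<le> l then g l else 0) = (\<Sum>l\<in>{k..p}. g l)"
    by (rule sum.mono_neutral_cong_right) auto
  also have "\<dots> = (\<Sum>i\<le>p - k. g (k + i))"
    by (rule sum.reindex_bij_witness[of _ "\<lambda>i. k + i" "\<lambda>l. l - k"]) (use that in auto)
  finally show ?thesis .
qed

lemma H_const_entries:
  assumes adm: "admissible r lam"
  shows "\<lbrakk>i \<le> p; j \<le> p\<rbrakk> \<Longrightarrow> H_const p r lam $$ (i, j) = (if i \<le> j then - 1 / fact (j - i) else 0)"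
    and "\<lbrakk>i \<le> p; c < 2 * r\<rbrakk> \<Longrightarrow> H_const p r lam $$ (i, p + 1 + c) = Q_mat p r lam $$ (i, c)"
    and "\<lbrakk>a < 2 * r; j \<le> p\<rbrakk> \<Longrightarrow> H_const p r lam $$ (p + 1 + a, j) = 0"
    and "\<lbrakk>a < 2 * r; c < 2 * r\<rbrakk> \<Longrightarrow> H_const p r lam $$ (p + 1 + a, p + 1 + c) =
      R_symbol p r lam 1 $$ (a, c) - (if a = c then 1 else 0)"
proof -
  have Q: "Q_mat p r lam \<in> carrier_mat (p + 1) (2 * r)"
    using is_Q_Q_mat[OF adm, of p] by (simp add: is_Q_def)
  have R: "R_symbol p r lam 1 \<in> carrier_mat (2 * r) (2 * r)"
    using L_mat_inverse(1)[OF adm, of p] unfolding R_symbol_def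
    by (intro mult_carrier_mat[where n = "2 * r"]) (auto simp: L_mat_def Delta_symbol_def)
  have T: "T_symbol p 1 \<in> carrier_mat (p + 1) (p + 1)" by (simp add: T_symbol_def)
  have [simp]: "dim_row (T_symbol p 1) = p + 1" "dim_col (T_symbol p 1) = p + 1"
    "dim_row (R_symbol p r lam 1) = 2 * r" "dim_col (R_symbol p r lam 1) = 2 * r"
    using T R by auto
  note defs = H_const_def H_symbol_def
  show "\<lbrakk>i \<le> p; j \<le> p\<rbrakk> \<Longrightarrow> H_const p r lam $$ (i, j) = (if i \<le> j then - 1 / fact (j - i) else 0)"
    by (auto simp: defs T_symbol_def)
  show "\<lbrakk>i \<le> p; c < 2 * r\<rbrakk> \<Longrightarrow> H_const p r lam $$ (i, p + 1 + c) = Q_mat p r lam $$ (i, c)"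
    using Q by (auto simp: defs)
  show "\<lbrakk>a < 2 * r; j \<le> p\<rbrakk> \<Longrightarrow> H_const p r lam $$ (p + 1 + a, j) = 0"
    by (auto simp: defs)
  show "\<lbrakk>a < 2 * r; c < 2 * r\<rbrakk> \<Longrightarrow> H_const p r lam $$ (p + 1 + a, p + 1 + c) =
      R_symbol p r lam 1 $$ (a, c) - (if a = c then 1 else 0)"
    by (auto simp: defs)
qed

text \<open>
  The vectors of powers of a frequency are eigenvectors of \<^const>\<open>H_const\<close>. For the upper rows
  this is the defining equation of \<open>Q\<close>; for the lower rows it says that the columns of the
  matrix \<open>L\<close> diagonalize \<open>R\<close>.
\<close>

lemma H_const_exponential:
  assumes adm: "admissible r lam" and k: "k < p + 2 * r + 1" and c: "c < 2 * r"
  defines "\<mu> \<equiv> freq lam c"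
  shows "(\<Sum>l = 0..<p + 2 * r + 1. H_const p r lam $$ (k, l) * \<mu> ^ l) = - exp \<mu> * \<mu> ^ k"
proof (cases "k \<le> p")
  case True
  have Q: "\<mu> ^ k * exp \<mu> - (\<Sum>i\<le>p - k. \<mu> ^ (k + i) / fact i)
          + (\<Sum>m = p + 1..p + 2 * r. \<mu> ^ m * Q_mat p r lam $$ (k, m - (p + 1))) = 0"
    using is_Q_Q_mat[OF adm, of p] True c unfolding is_Q_def Let_def \<mu>_def by blast
  have "(\<Sum>l\<le>p. H_const p r lam $$ (k, l) * \<mu> ^ l) =
      (\<Sum>l\<le>p. if k \<le> l then - (\<mu> ^ l / fact (l - k)) else 0)"
    using True by (intro sum.cong) (auto simp: H_const_entries[OF adm])
  also have "\<dots> = - (\<Sum>i\<le>p - k. \<mu> ^ (k + i) / fact i)"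
    using sum_upper_part[OF True, of "\<lambda>l. - (\<mu> ^ l / fact (l - k))"] by (simp add: sum_negf)
  finally have poly: "(\<Sum>l\<le>p. H_const p r lam $$ (k, l) * \<mu> ^ l) = \<dots>" .
  have "(\<Sum>b<2 * r. H_const p r lam $$ (k, p + 1 + b) * \<mu> ^ (p + 1 + b)) =
      (\<Sum>m = p + 1..p + 2 * r. \<mu> ^ m * Q_mat p r lam $$ (k, m - (p + 1)))"
    by (rule sum.reindex_bij_witness[of _ "\<lambda>m. m - (p + 1)" "\<lambda>b. p + 1 + b"])
       (use True in \<open>auto simp: H_const_entries(2)[OF adm, simplified] mult.commute\<close>)
  then show ?thesis unfolding sum_split_blocks poly using Q
    by (simp add: eq_neg_iff_add_eq_0 add.commute mult.commute) (simp add: algebra_simps)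
next
  case False
  then obtain a where a: "k = p + 1 + a" "a < 2 * r"
    using k upper_index by blast
  let ?L = "L_mat p r lam" and ?R = "R_symbol p r lam 1"
  have L: "?L \<in> carrier_mat (2 * r) (2 * r)" by (simp add: L_mat_def)
  have D: "Delta_symbol r lam 1 \<in> carrier_mat (2 * r) (2 * r)" by (simp add: Delta_symbol_def)
  note L' = L_mat_inverse[OF adm, of p]
  have R: "?R \<in> carrier_mat (2 * r) (2 * r)"
    unfolding R_symbol_def using L D L'(1) by (meson mult_carrier_mat)
  have "?R * ?L = ?L * Delta_symbol r lam 1"
    unfolding R_symbol_def using L D L'
    by (simp add: assoc_mult_mat[where n\<^sub>1 = "2 * r" and n\<^sub>2 = "2 * r" and n\<^sub>3 = "2 * r" and n\<^sub>4 = "2 * r"])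
  then have "(?R * ?L) $$ (a, c) = (?L * Delta_symbol r lam 1) $$ (a, c)" by simp
  moreover have "(?R * ?L) $$ (a, c) = (\<Sum>b<2 * r. ?R $$ (a, b) * \<mu> ^ (p + 1 + b))"
    using a c R by (simp add: L_mat_def scalar_prod_def lessThan_atLeast0 \<mu>_def)
  moreover have "(?L * Delta_symbol r lam 1) $$ (a, c) = \<mu> ^ k * (1 - exp \<mu>)"
    using a c by (simp add: L_mat_def Delta_symbol_def scalar_prod_def \<mu>_def
        if_distrib[of "\<lambda>u. _ * u"] cong: if_cong)
  ultimately have R_row: "(\<Sum>b<2 * r. ?R $$ (a, b) * \<mu> ^ (p + 1 + b)) = \<mu> ^ k * (1 - exp \<mu>)"
    by simp
  have "(\<Sum>b<2 * r. H_const p r lam $$ (k, p + 1 + b) * \<mu> ^ (p + 1 + b)) =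
      (\<Sum>b<2 * r. ?R $$ (a, b) * \<mu> ^ (p + 1 + b) - (if b = a then \<mu> ^ k else 0))"
    unfolding a(1) by (intro sum.cong refl, subst H_const_entries(4)[OF adm])
      (use a in \<open>auto simp: algebra_simps\<close>)
  also have "\<dots> = - exp \<mu> * \<mu> ^ k"
    using a R_row by (simp add: sum_subtractf algebra_simps)
  finally show ?thesis unfolding sum_split_blocks
    using a(2) H_const_entries(3)[OF adm, of a _ p] by (simp add: a(1))
qed

text \<open>
  The annihilating operator maps all samples to zero: \<open>- C\<close> is the transfer matrix that
  advances the samples by one node. On monomials this is Taylor's formula, that is, the
  binomial theorem; on exponentials it is the eigenvector property.
\<close>

lemma H_const_mult_jet_mat:
  assumes adm: "admissible r lam"
  shows "H_const p r (scaled n lam) * jet_mat p r lam n \<alpha> = - jet_mat p r lam n (\<alpha> + 1)"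
proof (rule eq_matI)
  note adm' = admissible_scaled[OF adm, of n]
  note C = H_symbol_affine(1)[OF adm', of p]
  let ?C = "H_const p r (scaled n lam)" and ?W = "jet_mat p r lam n"
  fix k j assume "k < dim_row (- ?W (\<alpha> + 1))" "j < dim_col (- ?W (\<alpha> + 1))"
  then have kj: "k < p + 2 * r + 1" "j < p + 2 * r + 1" by (auto simp: jet_mat_def)
  have entry: "(?C * ?W \<alpha>) $$ (k, j) = (\<Sum>l = 0..<p + 2 * r + 1. ?C $$ (k, l) * ?W \<alpha> $$ (l, j))"
    using kj C by (simp add: scalar_prod_def jet_mat_def)
  have "(?C * ?W \<alpha>) $$ (k, j) = - ?W (\<alpha> + 1) $$ (k, j)"
  proof (cases "j \<le> p")
    case True
    define u :: complex where "u = (1 / 2) ^ (n * j) * fact j"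
    have W: "?W \<beta> $$ (l, j) = (if l \<le> j then u / fact (j - l) * of_int \<beta> ^ (j - l) else 0)"
      if "l < p + 2 * r + 1" for l \<beta>
      using jet_mat_polynomial[OF that True] by (simp add: u_def)
    have tail: "(\<Sum>c<2 * r. ?C $$ (k, p + 1 + c) * ?W \<alpha> $$ (p + 1 + c, j)) = 0"
      using True by (intro sum.neutral) (auto simp: W)
    show ?thesis
    proof (cases "k \<le> j")
      case le: True
      have "(\<Sum>l\<le>p. ?C $$ (k, l) * ?W \<alpha> $$ (l, j)) =
          (\<Sum>l\<le>j. if k \<le> l then - u / (fact (l - k) * fact (j - l)) * of_int \<alpha> ^ (j - l) else 0)"
        using True le by (intro sum.mono_neutral_cong_right) (auto simp: W H_const_entries(1)[OF adm'])
      also have "\<dots> = (\<Sum>i\<le>j - k. - (u / fact (j - k) * (of_nat ((j - k) choose i) * of_int \<alpha> ^ (j - k - i))))"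
        unfolding sum_upper_part[OF le]
        by (intro sum.cong refl) (simp add: binomial_fact)
      also have "\<dots> = - (u / fact (j - k) * (1 + of_int \<alpha>) ^ (j - k))"
        unfolding binomial_ring by (simp add: sum_negf sum_distrib_left)
      finally show ?thesis
        unfolding entry sum_split_blocks tail using kj le by (simp add: W add.commute)
    next
      case False
      have "(\<Sum>l\<le>p. ?C $$ (k, l) * ?W \<alpha> $$ (l, j)) = 0"
      proof (cases "k \<le> p")
        case True
        with False show ?thesis 
          by (intro sum.neutral) (auto simp: W H_const_entries(1)[OF adm'])
      next
        case high: False
        then obtain a where "k = p + 1 + a" "a < 2 * r"
          using kj upper_index by blast
        then show ?thesis
          by (intro sum.neutral) (auto simp: H_const_entries(3)[OF adm', simplified])
      qed
      then show ?thesis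
        unfolding entry sum_split_blocks tail using kj False by (simp add: W)
    qed
  next
    case False
    then obtain c where c: "j = p + 1 + c" "c < 2 * r"
    using kj upper_index by blast
    define \<mu> where "\<mu> = freq (scaled n lam) c"
    have W: "?W \<beta> $$ (l, j) = \<mu> ^ l * exp (\<mu> * of_int \<beta>)" if "l < p + 2 * r + 1" for l \<beta>
      using jet_mat_exponential[OF that c(2)] by (simp add: c(1) \<mu>_def)
    have "(\<Sum>l = 0..<p + 2 * r + 1. ?C $$ (k, l) * ?W \<alpha> $$ (l, j)) =
        (\<Sum>l = 0..<p + 2 * r + 1. ?C $$ (k, l) * \<mu> ^ l) * exp (\<mu> * of_int \<alpha>)"
      unfolding sum_distrib_right by (intro sum.cong) (auto simp: W)
    also have "\<dots> = - (\<mu> ^ k * exp (\<mu> * of_int (\<alpha> + 1)))"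
      unfolding \<mu>_def H_const_exponential[OF adm' kj(1) c(2)] by (simp add: exp_add distrib_left)
    finally show ?thesis using kj unfolding entry by (simp add: W)
  qed
  then show "(?C * ?W \<alpha>) $$ (k, j) = (- ?W (\<alpha> + 1)) $$ (k, j)"
    using kj by (simp add: jet_mat_def)
qed (use H_symbol_affine(1)[OF admissible_scaled[OF adm, of n], of p] in \<open>auto simp: jet_mat_def\<close>)

section \<open>Reality of the annihilating operator\<close>

text \<open>
  Real frequencies are fixed by conjugation, and each purely imaginary one is exchanged with its
  negative, which is again a frequency.
\<close>

lemma cnj_jet_mat:
  assumes adm: "admissible r lam" and j: "j < p + 2 * r + 1"
  obtains j' where "j' < p + 2 * r + 1"
    "\<And>k \<alpha>. k < p + 2 * r + 1 \<Longrightarrow>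
       cnj (jet_mat p r lam n \<alpha> $$ (k, j)) = jet_mat p r lam n \<alpha> $$ (k, j')"
proof (cases "j \<le> p")
  case True
  show ?thesis
    by (rule that[OF j]) (use True in \<open>auto simp: jet_mat_polynomial\<close>)
next
  case False
  then obtain c where c: "j = p + 1 + c" "c < 2 * r"
    using j upper_index by blast
  let ?mu = "freq (scaled n lam)"
  obtain c' where c': "c' < 2 * r" "cnj (?mu c) = ?mu c'"
  proof -
    have div: "c div 2 < r" using c by auto
    then consider "Im (lam (c div 2)) = 0" | "Re (lam (c div 2)) = 0"
      using adm by (auto simp: admissible_def)
    then show ?thesis
    proof cases
      case 1
      then have "cnj (lam (c div 2)) = lam (c div 2)" by (simp add: complex_eq_iff)
      then show ?thesis using that[of c] c by (simp add: freq_scaled) (simp add: freq_def)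
    next
      case 2
      then have cnj: "cnj (lam (c div 2)) = - lam (c div 2)" by (simp add: complex_eq_iff)
      define c' where "c' = (if even c then c + 1 else c - 1)"
      have "c' < 2 * r" "c' div 2 = c div 2" "even c' \<longleftrightarrow> odd c"
        using c by (auto simp: c'_def elim!: evenE oddE)
      then show ?thesis using that[of c'] cnj by (simp add: freq_scaled) (simp add: freq_def)
    qed
  qed
  show ?thesis
  proof (rule that[of "p + 1 + c'"])
    show "p + 1 + c' < p + 2 * r + 1" using c' by simp
    fix k \<alpha> assume k: "k < p + 2 * r + 1"
    show "cnj (jet_mat p r lam n \<alpha> $$ (k, j)) = jet_mat p r lam n \<alpha> $$ (k, p + 1 + c')"
      unfolding c(1) jet_mat_exponential[OF k c(2)] jet_mat_exponential[OF k c'(1)] 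
      by (simp add: exp_cnj c'(2))
  qed
qed

text \<open>
  Conjugating the transfer equation \<open>C * W 0 = - W 1\<close> permutes the columns of both sides in the
  same way. So the conjugate of \<open>C\<close> solves the same equation, and this has only one solution
  since \<open>W 0\<close> is nonsingular.
\<close>

lemma H_const_real:
  assumes adm: "admissible r lam"
  obtains C where "C \<in> carrier_mat (p + 2 * r + 1) (p + 2 * r + 1)"
    "H_const p r (scaled n lam) = map_mat complex_of_real C"
proof -
  let ?m = "p + 2 * r + 1"
  define C where "C = H_const p r (scaled n lam)"
  define W where "W = jet_mat p r lam n"
  have C: "C \<in> carrier_mat ?m ?m"
    unfolding C_def by (rule H_symbol_affine(1)[OF admissible_scaled[OF adm]])
  have W [simp]: "dim_row (W \<alpha>) = ?m" "dim_col (W \<alpha>) = ?m" for \<alpha> by (simp_all add: W_def jet_mat_def)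
  have CW: "C * W 0 = - W 1"
    using H_const_mult_jet_mat[OF adm, of p n 0] by (simp add: C_def W_def)
  have same: "map_mat cnj C * W 0 = C * W 0"
  proof (rule eq_matI)
    fix k j assume "k < dim_row (C * W 0)" "j < dim_col (C * W 0)"
    then have kj: "k < ?m" "j < ?m" using C by auto
    obtain j' where j': "j' < ?m" "\<And>l \<alpha>. l < ?m \<Longrightarrow> cnj (W \<alpha> $$ (l, j)) = W \<alpha> $$ (l, j')"
      using cnj_jet_mat[OF adm kj(2)] unfolding W_def by blast
    have "(map_mat cnj C * W 0) $$ (k, j) = (\<Sum>l = 0..<?m. cnj (C $$ (k, l)) * W 0 $$ (l, j))"
      using kj C by (simp add: scalar_prod_def)
    also have "\<dots> = cnj (\<Sum>l = 0..<?m. C $$ (k, l) * W 0 $$ (l, j'))"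
      unfolding cnj_sum by (intro sum.cong refl) (simp add: j'(2)[symmetric])
    also have "(\<Sum>l = 0..<?m. C $$ (k, l) * W 0 $$ (l, j')) = (C * W 0) $$ (k, j')"
      using kj j'(1) C by (simp add: scalar_prod_def)
    also have "cnj \<dots> = (C * W 0) $$ (k, j)"
      unfolding CW using kj j' by (simp add: j'(2)[symmetric])
    finally show "(map_mat cnj C * W 0) $$ (k, j) = (C * W 0) $$ (k, j)" .
  qed (use C in auto)
  have cC: "map_mat cnj C \<in> carrier_mat ?m ?m" using C by simp
  have W0: "W 0 \<in> carrier_mat ?m ?m" unfolding W_def by (rule jet_mat_carrier)
  have "(map_mat cnj C - C) * W 0 = 0\<^sub>m ?m ?m"
    unfolding minus_mult_distrib_mat[OF cC C W0] same
    by (rule minus_r_inv_mat[OF mult_carrier_mat[OF C W0]])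
  then have zero: "map_mat cnj C - C = 0\<^sub>m ?m ?m"
    by (rule mat_eq_0_if_mult_nonsingular[OF minus_carrier_mat[OF C] W0 det_jet_mat[OF adm, of p n, folded W_def]])
  have cnj: "cnj (C $$ (k, j)) = C $$ (k, j)" if kj: "k < ?m" "j < ?m" for k j
  proof -
    have "cnj (C $$ (k, j)) - C $$ (k, j) = (map_mat cnj C - C) $$ (k, j)"
      using kj C by simp
    then show ?thesis unfolding zero using kj by simp
  qed
  have "C = map_mat complex_of_real (map_mat Re C)"
  proof (rule eq_matI)
    fix k j
    assume "k < dim_row (map_mat complex_of_real (map_mat Re C))"
      "j < dim_col (map_mat complex_of_real (map_mat Re C))"
    then have kj: "k < ?m" "j < ?m" using C by auto
    have "C $$ (k, j) = complex_of_real (Re (C $$ (k, j)))"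
      using cnj[OF kj] Reals_cnj_iff of_real_Re by metis
    then show "C $$ (k, j) = map_mat complex_of_real (map_mat Re C) $$ (k, j)"
      using kj C by simp
  qed (use C in auto)
  moreover have "map_mat Re C \<in> carrier_mat ?m ?m" using C by simp
  ultimately show ?thesis by (intro that[of "map_mat Re C"]) (simp_all only: C_def)
qed

section \<open>Factorization\<close>

text \<open>
  Applying the mask takes samples of level \<open>n\<close> to samples of level \<open>n + 1\<close>, and the annihilating
  operator of that level kills them.
\<close>

lemma refined_mask_annihilates_samples:
  assumes adm: "admissible r lam" and A: "is_mask (p + 2 * r + 1) (cmask A)"
    and spectral: "\<And>f. f \<in> V_space p r lam \<Longrightarrow>
      subdivision (p + 2 * r + 1) (cmask A) (hermite_seq (p + 2 * r) f n)
        = hermite_seq (p + 2 * r) f (n + 1)"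
    and ij: "i < p + 2 * r + 1" "j < p + 2 * r + 1"
  defines "C \<equiv> H_const p r (scaled (n + 1) lam)"
  shows "Sum_any (\<lambda>\<beta>. ((cmask A (\<alpha> - 2 * \<beta> + 1) + C * cmask A (\<alpha> - 2 * \<beta>)) * jet_mat p r lam n \<beta>) $$ (i, j)) = 0"
proof -
  let ?m = "p + 2 * r + 1"
  define G where "G \<alpha> = cmask A (\<alpha> + 1) + C * cmask A \<alpha>" for \<alpha>
  define h where "h = hermite_seq (p + 2 * r) (basis_fun p lam j)"
  have C: "C \<in> carrier_mat ?m ?m"
    unfolding C_def by (rule H_symbol_affine(1)[OF admissible_scaled[OF adm]])
  have h: "h k \<beta> \<in> carrier_vec ?m" for k \<beta> by (simp add: h_def hermite_seq_def)
  have col: "col (jet_mat p r lam k \<beta>) j = h k \<beta>" for k \<beta>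
    using ij h by (intro eq_vecI) (auto simp: jet_mat_def h_def hermite_seq_def)
  have G: "is_mask ?m G"
    unfolding G_def by (intro is_mask_add is_mask_shift is_mask_mult A C)
  have refine: "subdivision ?m (cmask A) (h n) = h (n + 1)"
    unfolding h_def by (rule spectral[OF basis_fun_in_V_space[OF ij(2)]])
  have "(G \<gamma> * jet_mat p r lam n \<beta>) $$ (i, j) = (G \<gamma> *\<^sub>v h n \<beta>) $ i" for \<gamma> \<beta>
    using ij is_mask_carrier[OF G, of \<gamma>] col[of n \<beta>] by (simp add: jet_mat_def)
  then have "Sum_any (\<lambda>\<beta>. (G (\<alpha> - 2 * \<beta>) * jet_mat p r lam n \<beta>) $$ (i, j)) = subdivision ?m G (h n) \<alpha> $ i"
    using ij by (simp add: subdivision_index)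
  also have "subdivision ?m G (h n) \<alpha> = h (n + 1) (\<alpha> + 1) + C *\<^sub>v h (n + 1) \<alpha>"
    unfolding G_def subdivision_add_mask[OF is_mask_shift[OF A] is_mask_mult(1)[OF A C] h]
      subdivision_shift_output subdivision_mult_left[OF A C h] refine ..
  also have "C *\<^sub>v h (n + 1) \<alpha> = - h (n + 1) (\<alpha> + 1)"
  proof -
    have "C *\<^sub>v h (n + 1) \<alpha> = col (C * jet_mat p r lam (n + 1) \<alpha>) j"
      using ij C by (subst col_mult2[OF C jet_mat_carrier]) (auto simp: col)
    also have "\<dots> = - col (jet_mat p r lam (n + 1) (\<alpha> + 1)) j"
      unfolding C_def H_const_mult_jet_mat[OF adm]
      using ij by (intro eq_vecI) (auto simp: jet_mat_def)
    finally show ?thesis unfolding col .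
  qed
  also have "(h (n + 1) (\<alpha> + 1) + - h (n + 1) (\<alpha> + 1)) $ i = 0"
    using ij h[of "n + 1" "\<alpha> + 1"] by simp
  finally show ?thesis by (simp add: G_def)
qed

text \<open>
  The division takes place over the reals, which yields a real quotient; its vanishing far to the
  right is tested over the complex numbers, where the samples live.
\<close>

lemma spectral_mask_factorization:
  fixes A :: "int \<Rightarrow> real mat"
  assumes adm: "admissible r lam" and A: "is_mask (p + 2 * r + 1) A"
    and spectral: "\<And>f. f \<in> V_space p r lam \<Longrightarrow>
      subdivision (p + 2 * r + 1) (cmask A) (hermite_seq (p + 2 * r) f n)
        = hermite_seq (p + 2 * r) f (n + 1)"
  obtains B :: "int \<Rightarrow> real mat" where "is_mask (p + 2 * r + 1) B"
    "\<And>\<alpha>. cmask B (\<alpha> + 2) + cmask B \<alpha> * H_const p r (scaled n lam) =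
      cmask A (\<alpha> + 1) + H_const p r (scaled (n + 1) lam) * cmask A \<alpha>"
proof -
  let ?m = "p + 2 * r + 1"
  obtain C where C: "C \<in> carrier_mat ?m ?m"
    and C_eq: "H_const p r (scaled n lam) = map_mat complex_of_real C"
    using H_const_real[OF adm] by blast
  obtain D where D: "D \<in> carrier_mat ?m ?m"
    and D_eq: "H_const p r (scaled (n + 1) lam) = map_mat complex_of_real D"
    using H_const_real[OF adm] by blast
  define G where "G \<alpha> = A (\<alpha> + 1) + D * A \<alpha>" for \<alpha>
  have G: "is_mask ?m G"
    unfolding G_def by (intro is_mask_add is_mask_shift is_mask_mult A D)
  have fin: "finite {\<alpha>. G \<alpha> \<noteq> 0\<^sub>m ?m ?m}" using G by (simp add: is_mask_def)
  obtain a where a: "\<And>\<alpha>. G \<alpha> \<noteq> 0\<^sub>m ?m ?m \<Longrightarrow> a \<le> \<alpha>"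
    using bdd_below_finite[OF fin] unfolding bdd_below_def by blast
  obtain b where b: "\<And>\<alpha>. G \<alpha> \<noteq> 0\<^sub>m ?m ?m \<Longrightarrow> \<alpha> \<le> b"
    using bdd_above_finite[OF fin] unfolding bdd_above_def by blast
  have G_zero: "G \<alpha> = 0\<^sub>m ?m ?m" if "\<alpha> < a \<or> b < \<alpha>" for \<alpha>
    using a[of \<alpha>] b[of \<alpha>] that by linarith
  define B where "B = right_quotient ?m a G C"
  have B: "B \<alpha> \<in> carrier_mat ?m ?m" for \<alpha>
    unfolding B_def by (rule right_quotient_carrier[OF is_mask_carrier[OF G] C])
  have step: "B (\<alpha> + 2) + B \<alpha> * C = G \<alpha>" for \<alpha>
    unfolding B_def using G_zero by (intro right_quotient_step is_mask_carrier[OF G] C) auto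
  have low: "B \<alpha> = 0\<^sub>m ?m ?m" if "\<alpha> < a" for \<alpha>
    using that by (simp add: B_def right_quotient.simps)
  have hom: "map_mat complex_of_real (X + Y * Z) =
      map_mat complex_of_real X + map_mat complex_of_real Y * map_mat complex_of_real Z"
    if "X \<in> carrier_mat ?m ?m" "Y \<in> carrier_mat ?m ?m" "Z \<in> carrier_mat ?m ?m" for X Y Z
    unfolding of_real_hom.mat_hom_mult[OF that(2,3), symmetric]
    by (rule eq_matI) (use that in auto)
  have cG: "cmask G \<alpha> = cmask A (\<alpha> + 1) + H_const p r (scaled (n + 1) lam) * cmask A \<alpha>" for \<alpha>
    unfolding cmask_def G_def D_eq by (rule hom) (intro is_mask_carrier[OF A] D)+
  have cstep: "cmask B (\<alpha> + 2) + cmask B \<alpha> * H_const p r (scaled n lam) = cmask G \<alpha>" for \<alpha>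
    unfolding cmask_def C_eq step[symmetric] by (rule hom[symmetric]) (intro B C)+
  have cmask_zero: "cmask X \<alpha> = 0\<^sub>m ?m ?m" if "X \<alpha> = 0\<^sub>m ?m ?m" for X \<alpha>
    using that by (auto simp: cmask_def)
  have high: "B \<alpha> = 0\<^sub>m ?m ?m" if "b < \<alpha>" for \<alpha>
  proof -
    have "cmask B \<alpha> = 0\<^sub>m ?m ?m"
    proof (rule quotient_mask_vanishes_high[where G = "cmask G" and W = "jet_mat p r lam n"
          and C = "H_const p r (scaled n lam)" and a = a and b = b])
      show "cmask B \<alpha> \<in> carrier_mat ?m ?m" for \<alpha> using B by (simp add: cmask_def)
      show "H_const p r (scaled n lam) \<in> carrier_mat ?m ?m" using C by (simp add: C_eq)
      show "cmask B \<alpha> = 0\<^sub>m ?m ?m" if "\<alpha> < a" for \<alpha>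
        using low[OF that] by (rule cmask_zero)
      show "cmask G \<alpha> = 0\<^sub>m ?m ?m" if "b < \<alpha>" for \<alpha>
        by (rule cmask_zero, rule G_zero) (use that in simp)
      show "Sum_any (\<lambda>\<beta>. (cmask G (\<alpha> - 2 * \<beta>) * jet_mat p r lam n \<beta>) $$ (i, j)) = 0"
        if "i < ?m" "j < ?m" for \<alpha> i j
        unfolding cG by (rule refined_mask_annihilates_samples[OF adm is_mask_cmask[OF A] spectral that])
    qed (fact cstep jet_mat_carrier det_jet_mat[OF adm] H_const_mult_jet_mat[OF adm] that)+
    then have "map_mat complex_of_real (B \<alpha>) = map_mat complex_of_real (0\<^sub>m ?m ?m)"
      by (auto simp: cmask_def)
    then show ?thesis by (rule of_real_hom.mat_hom_inj)
  qed
  have "is_mask ?m B"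
  proof -
    have "{\<alpha>. B \<alpha> \<noteq> 0\<^sub>m ?m ?m} \<subseteq> {a..b}"
    proof (intro subsetI, unfold mem_Collect_eq)
      fix \<alpha> assume "B \<alpha> \<noteq> 0\<^sub>m ?m ?m"
      then show "\<alpha> \<in> {a..b}" using low[of \<alpha>] high[of \<alpha>] by (meson atLeastAtMost_iff not_less)
    qed
    then show ?thesis using B by (auto simp: is_mask_def intro: finite_subset)
  qed
  then show ?thesis by (rule that) (simp only: cstep cG)
qed

lemma H_op_eq:
  assumes adm: "admissible r lam" and c: "\<And>\<alpha>. c \<alpha> \<in> carrier_vec (p + 2 * r + 1)"
  shows "H_op p r lam c \<alpha> = c (\<alpha> + 1) + H_const p r lam *\<^sub>v c \<alpha>"
proof (rule eq_vecI)
  let ?m = "p + 2 * r + 1" and ?C = "H_const p r lam"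
  note C = H_symbol_affine(1)[OF adm, of p]
  show "dim_vec (H_op p r lam c \<alpha>) = dim_vec (c (\<alpha> + 1) + ?C *\<^sub>v c \<alpha>)"
    using C by (simp add: H_op_def convolution_def)
  fix i assume "i < dim_vec (c (\<alpha> + 1) + ?C *\<^sub>v c \<alpha>)"
  then have i: "i < ?m" using C by simp
  define H where "H \<gamma> = (if \<gamma> = -1 then 1\<^sub>m ?m else if \<gamma> = 0 then ?C else 0\<^sub>m ?m ?m)" for \<gamma> :: int
  have "H_op p r lam c \<alpha> $ i = Sum_any (\<lambda>\<beta>. (H (\<alpha> - \<beta>) *\<^sub>v c \<beta>) $ i)"
    unfolding H_op_def impulse_response_H_symbol[OF adm] convolution_def H_def using i by simp
  also have "\<dots> = (\<Sum>\<beta>\<in>{\<alpha> + 1, \<alpha>}. (H (\<alpha> - \<beta>) *\<^sub>v c \<beta>) $ i)"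
  proof (rule Sum_any.expand_superset)
    have "(H (\<alpha> - \<beta>) *\<^sub>v c \<beta>) $ i = 0" if "\<beta> \<notin> {\<alpha> + 1, \<alpha>}" for \<beta>
    proof -
      have "H (\<alpha> - \<beta>) = 0\<^sub>m ?m ?m" using that by (auto simp: H_def)
      then show ?thesis using i c[of \<beta>] by simp
    qed
    then show "{\<beta>. (H (\<alpha> - \<beta>) *\<^sub>v c \<beta>) $ i \<noteq> 0} \<subseteq> {\<alpha> + 1, \<alpha>}" by blast
  qed simp
  also have "\<dots> = (c (\<alpha> + 1) + ?C *\<^sub>v c \<alpha>) $ i"
    using i c[of "\<alpha> + 1"] C by (simp add: H_def)
  finally show "H_op p r lam c \<alpha> $ i = (c (\<alpha> + 1) + ?C *\<^sub>v c \<alpha>) $ i" .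
qed

text \<open>
  The identity between the mask coefficients contains both forms of the factorization: here it
  is read as an identity of operators on arbitrary sequences, and in the next lemma as an
  identity of symbols. The sequences may have infinite support, so the operator form is proved
  directly and not through symbols.
\<close>

lemma operator_factorization:
  fixes lam lam' :: "nat \<Rightarrow> complex"
  assumes adm: "admissible r lam" "admissible r lam'"
    and A: "is_mask (p + 2 * r + 1) A" and B: "is_mask (p + 2 * r + 1) B"
    and AB: "\<And>\<alpha>. B (\<alpha> + 2) + B \<alpha> * H_const p r lam = A (\<alpha> + 1) + H_const p r lam' * A \<alpha>"
    and c: "\<And>\<alpha>. c \<alpha> \<in> carrier_vec (p + 2 * r + 1)"
  shows "H_op p r lam' (subdivision (p + 2 * r + 1) A c) =
    subdivision (p + 2 * r + 1) B (H_op p r lam c)"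
proof
  fix \<alpha>
  let ?m = "p + 2 * r + 1" and ?C = "H_const p r lam" and ?D = "H_const p r lam'"
  note C = H_symbol_affine(1)[OF adm(1), of p] and D = H_symbol_affine(1)[OF adm(2), of p]
  have Cc: "?C *\<^sub>v c \<beta> \<in> carrier_vec ?m" for \<beta> using C c by (rule mult_mat_vec_carrier)
  have "H_op p r lam' (subdivision ?m A c) \<alpha> =
      subdivision ?m A c (\<alpha> + 1) + ?D *\<^sub>v subdivision ?m A c \<alpha>"
    by (rule H_op_eq[OF adm(2) subdivision_carrier])
  also have "\<dots> = subdivision ?m (\<lambda>\<alpha>. A (\<alpha> + 1) + ?D * A \<alpha>) c \<alpha>"
    unfolding subdivision_add_mask[OF is_mask_shift[OF A] is_mask_mult(1)[OF A D] c]
      subdivision_shift_output subdivision_mult_left[OF A D c] ..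
  also have "\<dots> = subdivision ?m (\<lambda>\<alpha>. B (\<alpha> + 2) + B \<alpha> * ?C) c \<alpha>"
    by (simp only: AB)
  also have "\<dots> = subdivision ?m B (\<lambda>\<beta>. c (\<beta> + 1)) \<alpha> + subdivision ?m B (\<lambda>\<beta>. ?C *\<^sub>v c \<beta>) \<alpha>"
    unfolding subdivision_add_mask[OF is_mask_shift[OF B] is_mask_mult(2)[OF B C] c]
      subdivision_shift_input subdivision_mult_right[OF B C c] ..
  also have "\<dots> = subdivision ?m B (\<lambda>\<beta>. c (\<beta> + 1) + ?C *\<^sub>v c \<beta>) \<alpha>"
    by (rule subdivision_add_arg[OF B c Cc, symmetric])
  also have "(\<lambda>\<beta>. c (\<beta> + 1) + ?C *\<^sub>v c \<beta>) = H_op p r lam c"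
    by (rule ext) (rule H_op_eq[OF adm(1) c, symmetric])
  finally show "H_op p r lam' (subdivision ?m A c) \<alpha> = subdivision ?m B (H_op p r lam c) \<alpha>" .
qed

lemma symbol_factorization:
  fixes lam lam' :: "nat \<Rightarrow> complex"
  assumes adm: "admissible r lam" "admissible r lam'"
    and A: "is_mask (p + 2 * r + 1) A" and B: "is_mask (p + 2 * r + 1) B"
    and AB: "\<And>\<alpha>. B (\<alpha> + 2) + B \<alpha> * H_const p r lam = A (\<alpha> + 1) + H_const p r lam' * A \<alpha>"
    and z: "z \<noteq> 0"
  shows "H_symbol p r lam' z * symbol (p + 2 * r + 1) A z =
    symbol (p + 2 * r + 1) B z * H_symbol p r lam (z ^ 2)"
proof -
  let ?m = "p + 2 * r + 1" and ?C = "H_const p r lam" and ?D = "H_const p r lam'"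
  note C = H_symbol_affine(1)[OF adm(1), of p] and D = H_symbol_affine(1)[OF adm(2), of p]
  have I: "(1\<^sub>m ?m :: complex mat) \<in> carrier_mat ?m ?m" by simp
  have kI: "k \<cdot>\<^sub>m 1\<^sub>m ?m \<in> carrier_mat ?m ?m" for k :: complex by simp
  have "H_symbol p r lam' z * symbol ?m A z = inverse z \<cdot>\<^sub>m symbol ?m A z + ?D * symbol ?m A z"
    unfolding H_symbol_affine(2)[OF adm(2)] add_mult_distrib_mat[OF kI D symbol_carrier]
      mult_smult_assoc_mat[OF I symbol_carrier] left_mult_one_mat[OF symbol_carrier] ..
  also have "\<dots> = symbol ?m (\<lambda>\<alpha>. A (\<alpha> + 1) + ?D * A \<alpha>) z"
    unfolding symbol_add[OF is_mask_shift[OF A] is_mask_mult(1)[OF A D]]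
      symbol_mult_left[OF A D] symbol_shift[OF A z] by (simp add: power_int_minus)
  also have "\<dots> = symbol ?m (\<lambda>\<alpha>. B (\<alpha> + 2) + B \<alpha> * ?C) z"
    by (simp only: AB)
  also have "\<dots> = inverse (z ^ 2) \<cdot>\<^sub>m symbol ?m B z + symbol ?m B z * ?C"
    unfolding symbol_add[OF is_mask_shift[OF B] is_mask_mult(2)[OF B C]]
      symbol_mult_right[OF B C] symbol_shift[OF B z] by (simp add: power_int_minus)
  also have "\<dots> = symbol ?m B z * H_symbol p r lam (z ^ 2)"
    unfolding H_symbol_affine(2)[OF adm(1)] mult_add_distrib_mat[OF symbol_carrier kI C]
      mult_smult_distrib[OF symbol_carrier I] right_mult_one_mat[OF symbol_carrier] ..
  finally show ?thesis .
qed

theorem theorem16: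
  fixes p r n :: nat and lam :: "nat \<Rightarrow> complex" and A :: "int \<Rightarrow> real mat"
  assumes "r \<ge> 1"
    and "admissible r lam"
    and "is_mask (p + 2 * r + 1) A"
    and "\<And>f. f \<in> V_space p r lam \<Longrightarrow>
      subdivision (p + 2 * r + 1) (cmask A) (hermite_seq (p + 2 * r) f n)
        = hermite_seq (p + 2 * r) f (n + 1)"
  shows "\<exists>B :: int \<Rightarrow> real mat. is_mask (p + 2 * r + 1) B \<and>
    (\<forall>c. (\<forall>\<alpha>. c \<alpha> \<in> carrier_vec (p + 2 * r + 1)) \<longrightarrow>
       H_op p r (scaled (n + 1) lam) (subdivision (p + 2 * r + 1) (cmask A) c)
         = subdivision (p + 2 * r + 1) (cmask B) (H_op p r (scaled n lam) c)) \<and>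
    (\<forall>z. z \<noteq> 0 \<longrightarrow>
       H_symbol p r (scaled (n + 1) lam) z * symbol (p + 2 * r + 1) (cmask A) z
         = symbol (p + 2 * r + 1) (cmask B) z * H_symbol p r (scaled n lam) (z ^ 2))"
proof -
  obtain B where B: "is_mask (p + 2 * r + 1) B"
    and AB: "\<And>\<alpha>. cmask B (\<alpha> + 2) + cmask B \<alpha> * H_const p r (scaled n lam) =
      cmask A (\<alpha> + 1) + H_const p r (scaled (n + 1) lam) * cmask A \<alpha>"
    using spectral_mask_factorization[OF assms(2-4)] by blast
  note facts = admissible_scaled[OF assms(2)] admissible_scaled[OF assms(2)]
    is_mask_cmask[OF assms(3)] is_mask_cmask[OF B] AB
  show ?thesis
    by (intro exI[of _ B] conjI allI impI B operator_factorization[OF facts] symbol_factorization[OF facts]) auto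
qed

end
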